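(* Let $A_+,A_->0$, $t_+,t_->0$, $B\in\mathbb{R}$ with $B^2<A_+A_-$, and $n_+,n_-\in\mathbb{Z}$. Let $[f_+,f_-]$ be the solution of the radial problem (R) stated in the context with degree pair $[n_+,n_-]$. Then $$f_\pm(r)=t_\pm+\frac{a_\pm}{r^2}+\frac{b_\pm}{r^4}+O(r^{-6})\quad\text{as } r\to\infty,$$ with $$a_\pm=\frac12\,\frac{Bn_\mp^2-A_\mp n_\pm^2}{(A_+A_--B^2)\,t_\pm}$$ and $$b_\pm=-\frac{A_\mp^2(8n_\pm^2+n_\pm^4)t_\mp^2-BA_\mp(2n_\pm^2+8)n_\mp^2t_\mp^2-8BA_\pm n_\mp^2t_\pm^2+B^2(8t_\pm^2n_\pm^2+n_\mp^4t_\mp^2)}{8(A_+A_--B^2)^2\,t_\pm^3\,t_\mp^2}.$$ More specifically, let $A_\pm$ and $B_0>0$ be such that $A_+A_--B_0^2>0$. Then there exist positive constants $C_1,C_2,R$ such that $$\left|f_\pm(r)-\left(t_\pm+\frac{a_\pm}{r^2}+\frac{b_\pm}{r^4}\right)\right|\le\frac{C_1}{r^6}\qquad\text{and}\qquad\left|f_\pm'(r)+\frac{2a_\pm}{r^3}\right|\le\frac{C_2}{r^5}$$ hold for all $r\ge R$ and all $B$ with $|B|\le B_0$ (where $f_\pm$, $a_\pm$, $b_\pm$ are those associated with the value $B$, while $A_\pm$, $t_\pm$, $n_\pm$ are fixed, and $C_1,C_2,R$ do not depend on $B$).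
   Context: The radial problem (R) with degree pair $[n_+,n_-]$ and parameters $A_\pm,t_\pm,B$, for real-valued functions $f_+,f_-$ on $[0,\infty)$, is \begin{gather*} -f_+''-\tfrac1r f_+'+\tfrac{n_+^2}{r^2}f_++[A_+(f_+^2-t_+^2)+B(f_-^2-t_-^2)]f_+=0,\quad r\in(0,\infty),\\ -f_-''-\tfrac1r f_-'+\tfrac{n_-^2}{r^2}f_-+[A_-(f_-^2-t_-^2)+B(f_+^2-t_+^2)]f_-=0,\quad r\in(0,\infty),\\ f_\pm(r)\ge0\ \text{for all } r\in[0,\infty),\qquad f_\pm(r)\to t_\pm\ \text{as } r\to\infty,\\ f_\pm(0)=0\ \text{if } n_\pm\ne0,\qquad f_\pm'(0)=0\ \text{if } n_\pm=0. \end{gather*} Under the hypotheses $A_\pm>0$, $t_\pm>0$, $B^2<A_+A_-$ this problem has exactly one solution for each $[n_+,n_-]\in\mathbb{Z}^2$, and it is smooth on $(0,\infty)$. Formulas with $\pm$ and $\mp$ are read with upper signs throughout or lower signs throughout. *)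

theory Defs
  imports "HOL-Analysis.Analysis" "HOL-Library.Landau_Symbols"
begin

(* One component f of the radial problem.  The system is invariant under exchanging
   the roles of + and -, so each half is written from the point of view of "own" data
   (A, t, n, f) against the "other" data (s, g), where s is the limit at infinity
   belonging to g; the coupling B is shared.
   Functions on [0,oo) are represented by total functions real => real of which only
   the values on {0..} are constrained.  The derivatives in the equation are classical;
   the value at 0 is tied to the equation on (0,oo) by continuity on {0..}, and the
   derivative at 0 is one-sided. *)
definition radial_half ::
  "real \<Rightarrow> real \<Rightarrow> real \<Rightarrow> real \<Rightarrow> int \<Rightarrow> (real \<Rightarrow> real) \<Rightarrow> (real \<Rightarrow> real) \<Rightarrow> bool"
where
  "radial_half A B t s n f g \<longleftrightarrow>
     continuous_on {0..} f \<and>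
     (\<forall>r>0. f differentiable (at r) \<and> deriv f differentiable (at r) \<and>
        - deriv (deriv f) r - (1 / r) * deriv f r + ((of_int n)\<^sup>2 / r\<^sup>2) * f r
          + (A * ((f r)\<^sup>2 - t\<^sup>2) + B * ((g r)\<^sup>2 - s\<^sup>2)) * f r = 0) \<and>
     (\<forall>r\<ge>0. f r \<ge> 0) \<and>
     (f \<longlongrightarrow> t) at_top \<and>
     (n \<noteq> 0 \<longrightarrow> f 0 = 0) \<and>
     (n = 0 \<longrightarrow> (f has_real_derivative 0) (at 0 within {0..}))"

definition radial_solution ::
  "real \<Rightarrow> real \<Rightarrow> real \<Rightarrow> real \<Rightarrow> real \<Rightarrow> int \<Rightarrow> int
     \<Rightarrow> (real \<Rightarrow> real) \<Rightarrow> (real \<Rightarrow> real) \<Rightarrow> bool"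
where
  "radial_solution Ap Am B tp tm np nm fp fm \<longleftrightarrow>
     radial_half Ap B tp tm np fp fm \<and> radial_half Am B tm tp nm fm fp"

(* The coefficients a and b of a component with own data (A, t, n) against the other
   component's data (A', t', n'): the + coefficients are obtained with the + data first,
   the - coefficients with the - data first. *)
definition coeff_a :: "real \<Rightarrow> real \<Rightarrow> real \<Rightarrow> real \<Rightarrow> int \<Rightarrow> int \<Rightarrow> real" where
  "coeff_a A A' B t n n' =
     (1/2) * ((B * (of_int n')\<^sup>2 - A' * (of_int n)\<^sup>2) / ((A * A' - B\<^sup>2) * t))"

definition coeff_b :: "real \<Rightarrow> real \<Rightarrow> real \<Rightarrow> real \<Rightarrow> real \<Rightarrow> int \<Rightarrow> int \<Rightarrow> real" where
  "coeff_b A A' B t t' n n' =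
     - (A'\<^sup>2 * (8 * (of_int n)\<^sup>2 + (of_int n)^4) * t'\<^sup>2
        - B * A' * (2 * (of_int n)\<^sup>2 + 8) * (of_int n')\<^sup>2 * t'\<^sup>2
        - 8 * B * A * (of_int n')\<^sup>2 * t\<^sup>2
        + B\<^sup>2 * (8 * t\<^sup>2 * (of_int n)\<^sup>2 + (of_int n')^4 * t'\<^sup>2))
       / (8 * (A * A' - B\<^sup>2)\<^sup>2 * t^3 * t'\<^sup>2)"

end

theory Submission imports Defs begin

text \<open>
  For \<open>|B| \<le> B0\<close> the form \<open>A1 x\<^sup>2 + 2 B x y + A2 y\<^sup>2\<close> is uniformly positive definite, which makes every
  step uniform in \<open>B\<close> and in the solution. The maximum principle for \<open>f\<^sup>2 + g\<^sup>2\<close> gives an a priori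
  bound, and interior estimates bound the derivatives for \<open>r \<ge> 1\<close>. With the potential
  \<open>V = (A1 (f\<^sup>2 - t1\<^sup>2)\<^sup>2 + 2 B (f\<^sup>2 - t1\<^sup>2) (g\<^sup>2 - t2\<^sup>2) + A2 (g\<^sup>2 - t2\<^sup>2)\<^sup>2) / 4\<close>, the Pohozaev quantity
  \<open>((r f')\<^sup>2 + (r g')\<^sup>2 - n1\<^sup>2 f\<^sup>2 - n2\<^sup>2 g\<^sup>2) / 2 - r\<^sup>2 V\<close> has derivative \<open>- 2 r V\<close> and is bounded below, so
  \<open>r V\<close> has a bounded integral over \<open>r \<ge> 1\<close>; since \<open>V\<close> is Lipschitz, it is small beyond a uniform
  radius. There the deviations \<open>x\<close>, \<open>y\<close> of \<open>f\<close>, \<open>g\<close> from the truncated expansions satisfy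
  \<open>\<Delta> (x\<^sup>2 + y\<^sup>2) \<ge> c (x\<^sup>2 + y\<^sup>2) - C / r ^ 12\<close>, because the expansions solve the equations up to
  \<open>O(1 / r ^ 6)\<close>; comparison with a multiple of \<open>1 / r ^ 12\<close> gives the bound on the values, and the
  interior estimate the one on the derivatives.
\<close>

section \<open>Maximum principle and interior gradient estimate for the radial Laplacian\<close>

subsection \<open>Radial functions\<close>

text \<open>At an interior maximum above \<open>M\<close> the first derivative vanishes, so the
  strict inequality forces \<open>p'' > 0\<close> there. Then \<open>p'\<close> is positive just to
  the right and \<open>p\<close> climbs above its maximum.\<close>

lemma radial_max_principle:
  fixes p p' p'' :: "real \<Rightarrow> real"
  assumes cont: "continuous_on {a..b} p"
    and d1: "\<And>r. a < r \<Longrightarrow> r < b \<Longrightarrow> (p has_real_derivative p' r) (at r)"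
    and d2: "\<And>r. a < r \<Longrightarrow> r < b \<Longrightarrow> (p' has_real_derivative p'' r) (at r)"
    and sub: "\<And>r. a < r \<Longrightarrow> r < b \<Longrightarrow> p r > M \<Longrightarrow> p'' r + p' r / r > 0"
    and bd: "p a \<le> M" "p b \<le> M" and x: "x \<in> {a..b}"
  shows "p x \<le> M"
proof (rule ccontr)
  assume "\<not> p x \<le> M"
  obtain c where c: "c \<in> {a..b}" "\<And>y. y \<in> {a..b} \<Longrightarrow> p y \<le> p c"
    using continuous_attains_sup[OF compact_Icc _ cont] x by blast
  have pc: "p c > M" using c(2)[OF x] \<open>\<not> p x \<le> M\<close> by simp
  have ac: "a < c" "c < b" using bd pc c(1) by (auto simp: less_le)
  define d where "d = min (c - a) (b - c)"
  have d: "d > 0" using ac by (simp add: d_def)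
  have in_ab: "y \<in> {a..b}" if "\<bar>c - y\<bar> < d" for y using that by (auto simp: d_def)
  have p'c: "p' c = 0"
    using DERIV_local_max[OF d1[OF ac] d] c(2) in_ab by blast
  then have "p'' c > 0" using sub[OF ac pc] by simp
  then obtain e where e: "e > 0" "\<And>h. 0 < h \<Longrightarrow> h < e \<Longrightarrow> p' c < p' (c + h)"
    using DERIV_pos_inc_right[OF d2[OF ac]] by blast
  define h where "h = min e d / 2"
  have h: "0 < h" "h < e" "h < d" using e d by (auto simp: h_def)
  have "\<exists>z>c. z < c + h \<and> p (c + h) - p c = (c + h - c) * p' z"
    using h ac by (intro MVT2) (auto intro!: d1 simp: d_def)
  then obtain z where z: "c < z" "z < c + h" "p (c + h) - p c = h * p' z" by auto
  have "p' z > 0" using e(2)[of "z - c"] z h p'c by simp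
  then have "p (c + h) > p c" using z(3) mult_pos_pos[OF h(1)] by fastforce
  with c(2)[OF in_ab[of "c + h"]] h show False by simp
qed

text \<open>The product \<open>r * p'\<close> has derivative \<open>r * (p'' + p' / r)\<close>,
  which \<open>H\<close> controls, and the mean value theorem supplies a point where
  \<open>|p'|\<close> is at most \<open>2 * M\<close>. Carrying \<open>r * p'\<close> back to
  \<open>x\<close> costs the factor \<open>(x + 1) / x <= 2\<close>.\<close>

lemma radial_gradient_bound:
  fixes p p' p'' :: "real \<Rightarrow> real"
  assumes "x \<ge> 1"
    and d1: "\<And>r. r \<in> {x..x+1} \<Longrightarrow> (p has_real_derivative p' r) (at r)"
    and d2: "\<And>r. r \<in> {x..x+1} \<Longrightarrow> (p' has_real_derivative p'' r) (at r)"
    and M: "\<And>r. r \<in> {x..x+1} \<Longrightarrow> \<bar>p r\<bar> \<le> M"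
    and H: "\<And>r. r \<in> {x..x+1} \<Longrightarrow> \<bar>p'' r + p' r / r\<bar> \<le> H"
  shows "\<bar>p' x\<bar> \<le> 4 * M + 2 * H"
proof -
  have "\<exists>z>x. z < x + 1 \<and> p (x + 1) - p x = (x + 1 - x) * p' z"
    by (rule MVT2) (auto intro!: d1)
  then obtain z where z: "x < z" "z < x + 1" "p (x + 1) - p x = p' z" by auto
  have "\<exists>y>x. y < z \<and> z * p' z - x * p' x = (z - x) * (p' y + y * p'' y)"
    using z by (intro MVT2) (auto intro!: derivative_eq_intros d2)
  then obtain y where y: "x < y" "y < z" "z * p' z - x * p' x = (z - x) * (p' y + y * p'' y)"
    by auto
  have H0: "H \<ge> 0" and M0: "M \<ge> 0" using M[of x] H[of x] by auto
  have eq: "p' y + y * p'' y = y * (p'' y + p' y / y)"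
    using y assms(1) by (simp add: field_simps)
  have "\<bar>p' y + y * p'' y\<bar> \<le> (x + 1) * H"
    unfolding eq abs_mult using y z assms(1) H[of y] by (intro mult_mono) auto
  then have "\<bar>z - x\<bar> * \<bar>p' y + y * p'' y\<bar> \<le> 1 * ((x + 1) * H)"
    using z by (intro mult_mono) auto
  then have 1: "\<bar>z * p' z - x * p' x\<bar> \<le> (x + 1) * H"
    unfolding y(3) abs_mult by simp
  have "\<bar>p' z\<bar> \<le> 2 * M" using M[of x] M[of "x+1"] z(3) by auto
  then have "\<bar>z * p' z\<bar> \<le> (x + 1) * (2 * M)"
    unfolding abs_mult using z assms(1) by (intro mult_mono) auto
  with 1 have "\<bar>x * p' x\<bar> \<le> (x + 1) * (2 * M + H)" by (simp add: distrib_left)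
  also have "\<dots> \<le> (2 * x) * (2 * M + H)"
    using assms(1) H0 M0 by (intro mult_right_mono) auto
  finally have "x * \<bar>p' x\<bar> \<le> x * (4 * M + 2 * H)"
    using assms(1) by (simp add: abs_mult algebra_simps)
  then show ?thesis using assms(1) by simp
qed

lemma radial_laplacian_sum_squares:
  fixes f g :: "real \<Rightarrow> real"
  assumes "(f has_real_derivative f' r) (at r)" "(f' has_real_derivative f'' r) (at r)"
    and "(g has_real_derivative g' r) (at r)" "(g' has_real_derivative g'' r) (at r)"
  shows "((\<lambda>r. (f r)\<^sup>2 + (g r)\<^sup>2) has_real_derivative 2 * f r * f' r + 2 * g r * g' r) (at r)"
    and "((\<lambda>r. 2 * f r * f' r + 2 * g r * g' r) has_real_derivative
       2 * (f' r)\<^sup>2 + 2 * (g' r)\<^sup>2 + 2 * f r * f'' r + 2 * g r * g'' r) (at r)"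
  by (auto intro!: derivative_eq_intros assms simp: power2_eq_square)

text \<open>Cayley-Hamilton for the symmetric matrix \<open>S\<close> of the form:
  \<open>tr S * S - S^2 = det S * I\<close>, and \<open>S^2\<close> is positive
  semidefinite.\<close>

lemma quadratic_form_lower_bound:
  fixes a b c x y :: real
  assumes "a > 0" "c > 0" "b\<^sup>2 \<le> b0\<^sup>2"
  shows "(a * c - b0\<^sup>2) / (a + c) * (x\<^sup>2 + y\<^sup>2) \<le> a * x\<^sup>2 + 2 * b * x * y + c * y\<^sup>2"
proof -
  have "(a * c - b0\<^sup>2) * (x\<^sup>2 + y\<^sup>2) \<le> (a * c - b\<^sup>2) * (x\<^sup>2 + y\<^sup>2)"
    using assms by (intro mult_right_mono) auto
  also have "\<dots> = (a + c) * (a * x\<^sup>2 + 2 * b * x * y + c * y\<^sup>2)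
      - ((a * x + b * y)\<^sup>2 + (c * y + b * x)\<^sup>2)"
    by (simp add: power2_eq_square algebra_simps)
  also have "\<dots> \<le> (a + c) * (a * x\<^sup>2 + 2 * b * x * y + c * y\<^sup>2)" by simp
  finally show ?thesis using assms by (simp add: field_simps)
qed

lemma radial_halfD:
  assumes "radial_half A B t s n f g" "r > 0"
  shows "(f has_real_derivative deriv f r) (at r)"
    and "(deriv f has_real_derivative deriv (deriv f) r) (at r)"
    and "deriv (deriv f) r + deriv f r / r
      = ((of_int n)\<^sup>2 / r\<^sup>2 + A * ((f r)\<^sup>2 - t\<^sup>2) + B * ((g r)\<^sup>2 - s\<^sup>2)) * f r"
  using assms by (auto simp: radial_half_def DERIV_deriv_iff_real_differentiable algebra_simps)

subsection \<open>A priori bound\<close>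

locale radial_parameters =
  fixes A1 A2 t1 t2 :: real and n1 n2 :: int and B0 :: real
  assumes A1: "A1 > 0" and A2: "A2 > 0" and t1: "t1 > 0" and t2: "t2 > 0"
    and B0: "B0 > 0" and det: "A1 * A2 - B0\<^sup>2 > 0"
begin

text \<open>Determinant over trace at the extreme coupling \<open>B0\<close>: a lower bound for the
  eigenvalues of the form at every admissible \<open>B\<close>.\<close>

definition "ell = (A1 * A2 - B0\<^sup>2) / (A1 + A2)"

definition "lin = A1 * t1\<^sup>2 + A2 * t2\<^sup>2 + B0 * (t1\<^sup>2 + t2\<^sup>2)"

text \<open>From the first summand on, quadratic terms overtake linear ones; the next two keep
  \<open>mass\<close> above the limit of \<open>f^2 + g^2\<close>, and \<open>1\<close> gives
  \<open>mass <= mass^2\<close>.\<close>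

definition "mass = 2 * lin / ell + t1\<^sup>2 + t2\<^sup>2 + 1"

lemma ell_pos: "ell > 0" using A1 A2 det by (simp add: ell_def)

lemma lin_pos: "lin > 0" using A1 A2 t1 t2 B0 by (simp add: lin_def add_pos_pos)

lemma mass_gt: "mass > t1\<^sup>2 + t2\<^sup>2" "mass > 2 * lin / ell" "mass > 1"
proof -
  have "2 * lin / ell > 0" using ell_pos lin_pos by simp
  moreover have "t1\<^sup>2 > 0" "t2\<^sup>2 > 0" using t1 t2 by auto
  ultimately show "mass > t1\<^sup>2 + t2\<^sup>2" "mass > 2 * lin / ell" "mass > 1"
    unfolding mass_def by linarith+
qed

lemma form_ge:
  assumes "\<bar>B\<bar> \<le> B0"
  shows "ell * (x\<^sup>2 + y\<^sup>2) \<le> A1 * x\<^sup>2 + 2 * B * x * y + A2 * y\<^sup>2"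
proof -
  have "B\<^sup>2 \<le> B0\<^sup>2" using assms B0 by (simp add: abs_le_square_iff[symmetric])
  then show ?thesis unfolding ell_def using quadratic_form_lower_bound A1 A2 by blast
qed

text \<open>Here \<open>x\<close>, \<open>y\<close> stand for \<open>f^2\<close>,
  \<open>g^2\<close>. The quadratic part is at least \<open>ell / 2 * (x + y)^2\<close> and the
  linear part at most \<open>lin * (x + y)\<close>.\<close>

lemma nonlinearity_coercive:
  assumes B: "\<bar>B\<bar> \<le> B0" and xy: "x \<ge> 0" "y \<ge> 0" "x + y > mass"
  shows "x * (A1 * (x - t1\<^sup>2) + B * (y - t2\<^sup>2)) + y * (A2 * (y - t2\<^sup>2) + B * (x - t1\<^sup>2)) > 0"
proof -
  have "B * t1\<^sup>2 \<le> B0 * t1\<^sup>2" "B * t2\<^sup>2 \<le> B0 * t2\<^sup>2" using B by (auto intro!: mult_right_mono)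
  moreover have "A1 * t1\<^sup>2 \<ge> 0" "A2 * t2\<^sup>2 \<ge> 0" "B0 * t1\<^sup>2 \<ge> 0" "B0 * t2\<^sup>2 \<ge> 0"
    using A1 A2 B0 by auto
  ultimately have "A1 * t1\<^sup>2 + B * t2\<^sup>2 \<le> lin" "A2 * t2\<^sup>2 + B * t1\<^sup>2 \<le> lin"
    by (auto simp: lin_def algebra_simps)
  then have lin: "x * (A1 * t1\<^sup>2 + B * t2\<^sup>2) \<le> x * lin" "y * (A2 * t2\<^sup>2 + B * t1\<^sup>2) \<le> y * lin"
    using xy by (auto intro!: mult_left_mono)
  have pos: "x + y > 0" using xy mass_gt by linarith
  have "2 * lin / ell < x + y" using xy mass_gt by linarith
  then have "lin * (x + y) < ell / 2 * (x + y) * (x + y)"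
    using ell_pos pos by (intro mult_strict_right_mono) (auto simp: field_simps)
  also have "\<dots> \<le> ell * (x\<^sup>2 + y\<^sup>2)"
  proof -
    have "(x + y) * (x + y) / 2 \<le> x\<^sup>2 + y\<^sup>2"
      using sum_squares_ge_zero[of "x - y" 0] by (simp add: power2_eq_square algebra_simps)
    then have "ell * ((x + y) * (x + y) / 2) \<le> ell * (x\<^sup>2 + y\<^sup>2)"
      using ell_pos by (intro mult_left_mono) auto
    then show ?thesis by simp
  qed
  also have "\<dots> \<le> A1 * x\<^sup>2 + 2 * B * x * y + A2 * y\<^sup>2" by (rule form_ge[OF B])
  finally show ?thesis using lin by (simp add: power2_eq_square algebra_simps)
qed

end

text \<open>Kept apart from \<open>radial_parameters\<close> so that constants defined there depend
  on the coupling only through an explicit argument, and never on the solution.\<close>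

locale radial_pair = radial_parameters +
  fixes B :: real and f g :: "real \<Rightarrow> real"
  assumes B: "\<bar>B\<bar> \<le> B0"
    and half1: "radial_half A1 B t1 t2 n1 f g" and half2: "radial_half A2 B t2 t1 n2 g f"
begin

lemmas f_deriv = radial_halfD(1)[OF half1] and f_deriv2 = radial_halfD(2)[OF half1]
  and f_eq = radial_halfD(3)[OF half1]
lemmas g_deriv = radial_halfD(1)[OF half2] and g_deriv2 = radial_halfD(2)[OF half2]
  and g_eq = radial_halfD(3)[OF half2]

lemma lims: "(f \<longlongrightarrow> t1) at_top" "(g \<longlongrightarrow> t2) at_top"
  and nonneg: "r \<ge> 0 \<Longrightarrow> f r \<ge> 0" "r \<ge> 0 \<Longrightarrow> g r \<ge> 0"
  and conts: "continuous_on {0..} f" "continuous_on {0..} g"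
  using half1 half2 by (auto simp: radial_half_def)

text \<open>The gradient and centrifugal terms in the Laplacian of \<open>f^2 + g^2\<close> are
  nonnegative; the rest is twice the expression in \<open>nonlinearity_coercive\<close>.\<close>

lemma laplacian_squares_pos:
  assumes "r > 0" "(f r)\<^sup>2 + (g r)\<^sup>2 > mass"
  shows "2 * (deriv f r)\<^sup>2 + 2 * (deriv g r)\<^sup>2 + 2 * f r * deriv (deriv f) r + 2 * g r * deriv (deriv g) r
    + (2 * f r * deriv f r + 2 * g r * deriv g r) / r > 0"
proof -
  let ?F = "f r" and ?G = "g r"
  have "2 * ?F * deriv (deriv f) r + 2 * ?G * deriv (deriv g) r
      + (2 * ?F * deriv f r + 2 * ?G * deriv g r) / r
      = 2 * (?F * (deriv (deriv f) r + deriv f r / r) + ?G * (deriv (deriv g) r + deriv g r / r))"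
    by (simp add: algebra_simps add_divide_distrib)
  also have "\<dots> = 2 * ((of_int n1)\<^sup>2 / r\<^sup>2 * ?F\<^sup>2 + (of_int n2)\<^sup>2 / r\<^sup>2 * ?G\<^sup>2 +
      (?F\<^sup>2 * (A1 * (?F\<^sup>2 - t1\<^sup>2) + B * (?G\<^sup>2 - t2\<^sup>2)) + ?G\<^sup>2 * (A2 * (?G\<^sup>2 - t2\<^sup>2) + B * (?F\<^sup>2 - t1\<^sup>2))))"
    unfolding f_eq[OF assms(1)] g_eq[OF assms(1)] by (simp add: power2_eq_square algebra_simps)
  also have "\<dots> > 0"
  proof -
    have "(of_int n1)\<^sup>2 / r\<^sup>2 * ?F\<^sup>2 \<ge> 0" "(of_int n2)\<^sup>2 / r\<^sup>2 * ?G\<^sup>2 \<ge> 0" by auto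
    with nonlinearity_coercive[OF B zero_le_power2 zero_le_power2 assms(2)] show ?thesis
      by (intro mult_pos_pos[OF zero_less_numeral] add_nonneg_pos[OF add_nonneg_nonneg])
  qed
  finally show ?thesis using zero_le_power2[of "deriv f r"] zero_le_power2[of "deriv g r"]
    by linarith
qed

text \<open>Since \<open>ln\<close> is radially harmonic, adding a small multiple of \<open>ln (r / R)\<close> enforces the bound near the
  singular point \<open>0\<close> without using the boundary condition there.\<close>

lemma mass_bound:
  assumes x: "x > 0"
  shows "(f x)\<^sup>2 + (g x)\<^sup>2 \<le> mass"
proof -
  let ?q = "\<lambda>r. (f r)\<^sup>2 + (g r)\<^sup>2"
  have "(?q \<longlongrightarrow> t1\<^sup>2 + t2\<^sup>2) at_top" by (intro tendsto_intros lims)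
  then have "eventually (\<lambda>r. ?q r < mass) at_top" using mass_gt(1) order_tendstoD(2) by blast
  then have "eventually (\<lambda>r. ?q r < mass \<and> r > x) at_top"
    using eventually_conj eventually_gt_at_top by blast
  then obtain R where R: "?q R < mass" "R > x"
    using eventually_happens'[OF trivial_limit_at_top_linorder] by blast
  have qc: "continuous_on {0..} ?q" by (intro continuous_intros conts)
  have "compact (?q ` {0..x})"
    by (intro compact_continuous_image continuous_on_subset[OF qc]) auto
  then obtain S where S: "\<And>r. r \<in> {0..x} \<Longrightarrow> ?q r \<le> S"
    using bounded_imp_bdd_above[OF compact_imp_bounded] by (fastforce simp: bdd_above_def)
  have bound: "?q x + e * ln (x / R) \<le> mass" if e: "e > 0" for e
  proof -
    \<comment> \<open>So close to \<open>0\<close> that \<open>e * ln (a / R) <= - |S|\<close>: the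
      logarithm absorbs whatever value \<open>?q\<close> takes at \<open>a\<close>.\<close>
    define a where "a = min x (R * exp (- \<bar>S\<bar> / e))"
    have a: "0 < a" "a \<le> x" using x R by (auto simp: a_def)
    have "ln (a / R) \<le> ln (exp (- \<bar>S\<bar> / e))"
      using a x R by (subst ln_le_cancel_iff) (auto simp: a_def field_simps)
    then have "e * ln (a / R) \<le> - \<bar>S\<bar>" using e by (simp add: field_simps)
    then have pa: "?q a + e * ln (a / R) \<le> mass" using S[of a] a mass_gt(3) by auto
    show ?thesis
    proof (rule radial_max_principle[where p = "\<lambda>r. ?q r + e * ln (r / R)" and a = a and b = R
          and p' = "\<lambda>r. 2 * f r * deriv f r + 2 * g r * deriv g r + e / r"
          and p'' = "\<lambda>r. 2 * (deriv f r)\<^sup>2 + 2 * (deriv g r)\<^sup>2 + 2 * f r * deriv (deriv f) r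
             + 2 * g r * deriv (deriv g) r - e / r\<^sup>2"])
      show "continuous_on {a..R} (\<lambda>r. ?q r + e * ln (r / R))"
        using a x R by (intro continuous_intros continuous_on_subset[OF conts(1)]
            continuous_on_subset[OF conts(2)]) auto
    next
      fix r assume "a < r"
      then have r: "r > 0" using a by simp
      have R0: "R > 0" using x R by simp
      show "((\<lambda>r. ?q r + e * ln (r / R)) has_real_derivative
          2 * f r * deriv f r + 2 * g r * deriv g r + e / r) (at r)"
        using r R0 by (auto intro!: derivative_eq_intros radial_laplacian_sum_squares(1)
            f_deriv g_deriv f_deriv2 g_deriv2)
      show "((\<lambda>r. 2 * f r * deriv f r + 2 * g r * deriv g r + e / r) has_real_derivative
          2 * (deriv f r)\<^sup>2 + 2 * (deriv g r)\<^sup>2 + 2 * f r * deriv (deriv f) r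
             + 2 * g r * deriv (deriv g) r - e / r\<^sup>2) (at r)"
        using r by (auto intro!: derivative_eq_intros
            radial_laplacian_sum_squares(2)[where f = f and g = g]
            f_deriv g_deriv f_deriv2 g_deriv2 simp: power2_eq_square)
      assume "r < R" and gt: "?q r + e * ln (r / R) > mass"
      \<comment> \<open>The logarithm is negative here, so \<open>?q r\<close> itself exceeds
        \<open>mass\<close>. In the Laplacian its contributions \<open>- e / r^2\<close> and
        \<open>(e / r) / r\<close> cancel.\<close>
      then have "ln (r / R) < 0" using r R0 by simp
      then have "e * ln (r / R) < 0" using e by (simp add: mult_pos_neg)
      then have "?q r > mass" using gt by linarith
      from laplacian_squares_pos[OF r this] r
      show "2 * (deriv f r)\<^sup>2 + 2 * (deriv g r)\<^sup>2 + 2 * f r * deriv (deriv f) r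
             + 2 * g r * deriv (deriv g) r - e / r\<^sup>2
             + (2 * f r * deriv f r + 2 * g r * deriv g r + e / r) / r > 0"
        by (simp add: add_divide_distrib power2_eq_square)
    qed (use pa R a x in auto)
  qed
  have lnR: "ln (x / R) < 0" using x R by simp
  show ?thesis
  proof (rule field_le_epsilon)
    fix e :: real assume "e > 0"
    \<comment> \<open>With this coefficient the logarithmic term at \<open>x\<close> equals
      \<open>- e\<close>.\<close>
    with lnR have "e / - ln (x / R) > 0" by (intro divide_pos_pos) auto
    from bound[OF this] show "?q x \<le> mass + e" using lnR by simp
  qed
qed

end

section \<open>Pohozaev identity and a convergence radius independent of the solution\<close>

subsection \<open>Uniform convergence at infinity\<close>

context radial_parameters
begin

text \<open>Bound for the radial Laplacians on \<open>r >= 1\<close>; \<open>slope\<close> is the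
  gradient bound that follows from it and \<open>mass\<close>.\<close>

definition "force = ((of_int n1)\<^sup>2 + (of_int n2)\<^sup>2 + (A1 + A2 + B0) * mass) * mass"

definition "slope = 4 * mass + 2 * force"

definition "centrifugal = ((of_int n1)\<^sup>2 + (of_int n2)\<^sup>2) * mass"

definition "potential_slope = 2 * (A1 + A2 + B0) * mass * mass * slope"

text \<open>If the potential exceeds \<open>e\<close> at \<open>x\<close>, it stays above
  \<open>e / 2\<close> on an interval of length \<open>e / (2 * (potential_slope + 1))\<close>, over
  which \<open>pohozaev\<close> loses at least \<open>x * e\<close> times that length. The total
  loss is at most \<open>slope^2 + centrifugal\<close>; solving for \<open>x\<close> gives this
  radius.\<close>

definition settling_radius :: "real \<Rightarrow> real" where
  "settling_radius e = 1 + (slope\<^sup>2 + centrifugal) * (2 * (potential_slope + 1)) / e\<^sup>2"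

end

context radial_pair
begin

definition "potential r = (A1 * ((f r)\<^sup>2 - t1\<^sup>2)\<^sup>2
  + 2 * B * ((f r)\<^sup>2 - t1\<^sup>2) * ((g r)\<^sup>2 - t2\<^sup>2) + A2 * ((g r)\<^sup>2 - t2\<^sup>2)\<^sup>2) / 4"

definition "pohozaev r = ((r * deriv f r)\<^sup>2 + (r * deriv g r)\<^sup>2
  - (of_int n1)\<^sup>2 * (f r)\<^sup>2 - (of_int n2)\<^sup>2 * (g r)\<^sup>2) / 2 - r\<^sup>2 * potential r"

text \<open>The nonlinear terms of the two equations, multiplied by \<open>f'\<close> and
  \<open>g'\<close>: the potential is their primitive along the solution.\<close>

definition "potential' r =
    (A1 * ((f r)\<^sup>2 - t1\<^sup>2) + B * ((g r)\<^sup>2 - t2\<^sup>2)) * (f r * deriv f r)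
  + (A2 * ((g r)\<^sup>2 - t2\<^sup>2) + B * ((f r)\<^sup>2 - t1\<^sup>2)) * (g r * deriv g r)"

lemma values_bound:
  assumes "r > 0"
  shows "\<bar>f r\<bar> \<le> mass" "\<bar>g r\<bar> \<le> mass" "\<bar>(f r)\<^sup>2 - t1\<^sup>2\<bar> \<le> mass" "\<bar>(g r)\<^sup>2 - t2\<^sup>2\<bar> \<le> mass"
proof -
  note q = mass_bound[OF assms] and m = mass_gt
  have sq: "(f r)\<^sup>2 \<ge> 0" "(g r)\<^sup>2 \<ge> 0" "t1\<^sup>2 \<ge> 0" "t2\<^sup>2 \<ge> 0" by auto
  show "\<bar>(f r)\<^sup>2 - t1\<^sup>2\<bar> \<le> mass" "\<bar>(g r)\<^sup>2 - t2\<^sup>2\<bar> \<le> mass"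
    using q m sq unfolding abs_le_iff by linarith+
  have "mass * 1 \<le> mass * mass" using m by (intro mult_left_mono) auto
  then have "mass \<le> mass\<^sup>2" by (simp add: power2_eq_square)
  then have "(f r)\<^sup>2 \<le> mass\<^sup>2" "(g r)\<^sup>2 \<le> mass\<^sup>2" using q sq by linarith+
  then show "\<bar>f r\<bar> \<le> mass" "\<bar>g r\<bar> \<le> mass"
    using m by (auto simp: abs_le_square_iff[symmetric])
qed

lemma nonlinearity_bound:
  assumes "r > 0"
  shows "\<bar>A1 * ((f r)\<^sup>2 - t1\<^sup>2) + B * ((g r)\<^sup>2 - t2\<^sup>2)\<bar> \<le> (A1 + A2 + B0) * mass"
    and "\<bar>A2 * ((g r)\<^sup>2 - t2\<^sup>2) + B * ((f r)\<^sup>2 - t1\<^sup>2)\<bar> \<le> (A1 + A2 + B0) * mass"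
proof -
  note v = values_bound[OF assms]
  have "\<bar>A1 * ((f r)\<^sup>2 - t1\<^sup>2)\<bar> \<le> A1 * mass" "\<bar>A2 * ((g r)\<^sup>2 - t2\<^sup>2)\<bar> \<le> A2 * mass"
    using v A1 A2 by (auto simp: abs_mult)
  moreover have "\<bar>B * ((g r)\<^sup>2 - t2\<^sup>2)\<bar> \<le> B0 * mass" "\<bar>B * ((f r)\<^sup>2 - t1\<^sup>2)\<bar> \<le> B0 * mass"
    unfolding abs_mult using v B B0 by (auto intro!: mult_mono)
  moreover have "A1 * mass \<ge> 0" "A2 * mass \<ge> 0" using A1 A2 mass_gt by auto
  ultimately show "\<bar>A1 * ((f r)\<^sup>2 - t1\<^sup>2) + B * ((g r)\<^sup>2 - t2\<^sup>2)\<bar> \<le> (A1 + A2 + B0) * mass"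
    and "\<bar>A2 * ((g r)\<^sup>2 - t2\<^sup>2) + B * ((f r)\<^sup>2 - t1\<^sup>2)\<bar> \<le> (A1 + A2 + B0) * mass"
    unfolding distrib_right by linarith+
qed

lemma laplacian_bound:
  assumes "r \<ge> 1"
  shows "\<bar>deriv (deriv f) r + deriv f r / r\<bar> \<le> force"
    and "\<bar>deriv (deriv g) r + deriv g r / r\<bar> \<le> force"
proof -
  have r: "r > 0" using assms by simp
  note v = values_bound[OF r] and N = nonlinearity_bound[OF r]
  have "r\<^sup>2 \<ge> 1" using assms by simp
  then have n: "(of_int k)\<^sup>2 / r\<^sup>2 \<le> (of_int k :: real)\<^sup>2" "0 \<le> (of_int k :: real)\<^sup>2 / r\<^sup>2" for k
    by (auto simp: divide_le_eq mult_le_cancel_left1)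
  have sq: "0 \<le> (of_int n1 :: real)\<^sup>2" "0 \<le> (of_int n2 :: real)\<^sup>2" by auto
  have "\<bar>(of_int n1)\<^sup>2 / r\<^sup>2 + (A1 * ((f r)\<^sup>2 - t1\<^sup>2) + B * ((g r)\<^sup>2 - t2\<^sup>2))\<bar>
      \<le> (of_int n1)\<^sup>2 + (of_int n2)\<^sup>2 + (A1 + A2 + B0) * mass"
    using N(1) n[of n1] sq by linarith
  then show "\<bar>deriv (deriv f) r + deriv f r / r\<bar> \<le> force"
    unfolding f_eq[OF r] force_def abs_mult using v by (intro mult_mono) (auto simp: add.assoc)
  have "\<bar>(of_int n2)\<^sup>2 / r\<^sup>2 + (A2 * ((g r)\<^sup>2 - t2\<^sup>2) + B * ((f r)\<^sup>2 - t1\<^sup>2))\<bar>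
      \<le> (of_int n1)\<^sup>2 + (of_int n2)\<^sup>2 + (A1 + A2 + B0) * mass"
    using N(2) n[of n2] sq by linarith
  then show "\<bar>deriv (deriv g) r + deriv g r / r\<bar> \<le> force"
    unfolding g_eq[OF r] force_def abs_mult using v by (intro mult_mono) (auto simp: add.assoc)
qed

lemma slope_bound:
  assumes "r \<ge> 1"
  shows "\<bar>deriv f r\<bar> \<le> slope" "\<bar>deriv g r\<bar> \<le> slope"
proof -
  show "\<bar>deriv f r\<bar> \<le> slope" unfolding slope_def
    by (rule radial_gradient_bound[OF assms f_deriv f_deriv2 values_bound(1) laplacian_bound(1)])
      (use assms in auto)
  show "\<bar>deriv g r\<bar> \<le> slope" unfolding slope_def
    by (rule radial_gradient_bound[OF assms g_deriv g_deriv2 values_bound(2) laplacian_bound(2)])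
      (use assms in auto)
qed

lemma potential_deriv:
  assumes "r > 0"
  shows "(potential has_real_derivative potential' r) (at r)"
  unfolding potential_def[abs_def] potential'_def
  by (auto intro!: derivative_eq_intros f_deriv[OF assms] g_deriv[OF assms]
      simp: power2_eq_square field_simps)

text \<open>Multiplying the equation for \<open>f\<close> by \<open>r^2 * f'\<close> turns its
  radial Laplacian into half the derivative of \<open>(r * f')^2\<close>. The centrifugal terms and
  \<open>r^2 * potential'\<close> cancel; only the derivative of the weight \<open>r^2\<close>
  survives.\<close>

lemma pohozaev_deriv:
  assumes r: "r > 0"
  shows "(pohozaev has_real_derivative - 2 * r * potential r) (at r)"
proof -
  let ?f = "f r" and ?f1 = "deriv f r" and ?f2 = "deriv (deriv f) r"
  let ?g = "g r" and ?g1 = "deriv g r" and ?g2 = "deriv (deriv g) r"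
  have f2: "r * ?f1 * (?f1 + r * ?f2)
      = (of_int n1)\<^sup>2 * ?f * ?f1 + r\<^sup>2 * ((A1 * (?f\<^sup>2 - t1\<^sup>2) + B * (?g\<^sup>2 - t2\<^sup>2)) * (?f * ?f1))"
  proof -
    have "r * ?f1 * (?f1 + r * ?f2) = r\<^sup>2 * ?f1 * (?f2 + ?f1 / r)"
      using r by (simp add: power2_eq_square field_simps)
    also have "\<dots> = (of_int n1)\<^sup>2 * ?f * ?f1
        + r\<^sup>2 * ((A1 * (?f\<^sup>2 - t1\<^sup>2) + B * (?g\<^sup>2 - t2\<^sup>2)) * (?f * ?f1))"
      unfolding f_eq[OF r] using r by (simp add: field_simps)
    finally show ?thesis .
  qed
  have g2: "r * ?g1 * (?g1 + r * ?g2)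
      = (of_int n2)\<^sup>2 * ?g * ?g1 + r\<^sup>2 * ((A2 * (?g\<^sup>2 - t2\<^sup>2) + B * (?f\<^sup>2 - t1\<^sup>2)) * (?g * ?g1))"
  proof -
    have "r * ?g1 * (?g1 + r * ?g2) = r\<^sup>2 * ?g1 * (?g2 + ?g1 / r)"
      using r by (simp add: power2_eq_square field_simps)
    also have "\<dots> = (of_int n2)\<^sup>2 * ?g * ?g1
        + r\<^sup>2 * ((A2 * (?g\<^sup>2 - t2\<^sup>2) + B * (?f\<^sup>2 - t1\<^sup>2)) * (?g * ?g1))"
      unfolding g_eq[OF r] using r by (simp add: field_simps)
    finally show ?thesis .
  qed
  have "(pohozaev has_real_derivative
      (r * ?f1 * (?f1 + r * ?f2) + r * ?g1 * (?g1 + r * ?g2)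
       - (of_int n1)\<^sup>2 * ?f * ?f1 - (of_int n2)\<^sup>2 * ?g * ?g1)
      - (2 * r * potential r + r\<^sup>2 * potential' r)) (at r)"
    unfolding pohozaev_def[abs_def]
    by (auto intro!: derivative_eq_intros f_deriv[OF r] g_deriv[OF r] f_deriv2[OF r] g_deriv2[OF r]
        potential_deriv[OF r] simp: power2_eq_square field_simps)
  then show ?thesis unfolding f2 g2 potential'_def by (simp add: algebra_simps)
qed

lemma potential_ge: "ell * (((f r)\<^sup>2 - t1\<^sup>2)\<^sup>2 + ((g r)\<^sup>2 - t2\<^sup>2)\<^sup>2) \<le> 4 * potential r"
  using form_ge[OF B, of "(f r)\<^sup>2 - t1\<^sup>2" "(g r)\<^sup>2 - t2\<^sup>2"] by (simp add: potential_def)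

lemma potential_nonneg: "potential r \<ge> 0"
proof -
  have "ell * (((f r)\<^sup>2 - t1\<^sup>2)\<^sup>2 + ((g r)\<^sup>2 - t2\<^sup>2)\<^sup>2) \<ge> 0" using ell_pos by simp
  with potential_ge[of r] show ?thesis by linarith
qed

lemma potential_tendsto_0: "(potential \<longlongrightarrow> 0) at_top"
proof -
  have "(potential \<longlongrightarrow> (A1 * (t1\<^sup>2 - t1\<^sup>2)\<^sup>2
    + 2 * B * (t1\<^sup>2 - t1\<^sup>2) * (t2\<^sup>2 - t2\<^sup>2) + A2 * (t2\<^sup>2 - t2\<^sup>2)\<^sup>2) / 4) at_top"
    unfolding potential_def[abs_def] by (intro tendsto_intros lims) auto
  then show ?thesis by simp
qed

lemma centrifugal_bound:
  assumes "r > 0"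
  shows "(of_int n1)\<^sup>2 * (f r)\<^sup>2 + (of_int n2)\<^sup>2 * (g r)\<^sup>2 \<le> centrifugal"
proof -
  have "(f r)\<^sup>2 \<le> mass" "(g r)\<^sup>2 \<le> mass"
    using mass_bound[OF assms] zero_le_power2[of "f r"] zero_le_power2[of "g r"] by linarith+
  then have "(of_int n1)\<^sup>2 * (f r)\<^sup>2 \<le> (of_int n1)\<^sup>2 * mass"
    "(of_int n2)\<^sup>2 * (g r)\<^sup>2 \<le> (of_int n2)\<^sup>2 * mass" by (auto intro!: mult_left_mono)
  then show ?thesis by (simp add: centrifugal_def algebra_simps)
qed

text \<open>The lower bound on \<open>pohozaev\<close> makes \<open>(pohozaev r + centrifugal / 2) / r\<^sup>2\<close> nonincreasing, so a
  negative value would keep the potential away from \<open>0\<close>.\<close>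

lemma pohozaev_ge:
  assumes x: "x > 0"
  shows "pohozaev x \<ge> - centrifugal / 2"
proof (rule ccontr)
  define K where "K = centrifugal / 2"
  assume "\<not> pohozaev x \<ge> - centrifugal / 2"
  then have neg: "pohozaev x + K < 0" by (simp add: K_def)
  \<comment> \<open>Dropping the squares of the derivatives leaves the centrifugal part, which
    \<open>K\<close> absorbs.\<close>
  have ge: "pohozaev r + K \<ge> - (r\<^sup>2 * potential r)" if "r > 0" for r
    using centrifugal_bound[OF that] zero_le_power2[of "r * deriv f r"]
      zero_le_power2[of "r * deriv g r"] unfolding pohozaev_def K_def by argo
  have dec: "(pohozaev r + K) / r\<^sup>2 \<le> (pohozaev x + K) / x\<^sup>2" if "r \<ge> x" for r
  proof (rule DERIV_nonpos_imp_nonincreasing[OF that, of "\<lambda>r. (pohozaev r + K) / r\<^sup>2"])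
    fix y assume "x \<le> y" "y \<le> r"
    then have y: "y > 0" using x by simp
    have "((\<lambda>r. (pohozaev r + K) / r\<^sup>2) has_real_derivative
       (- 2 * (y\<^sup>2 * potential y + (pohozaev y + K))) / y ^ 3) (at y)"
      using y by (auto intro!: derivative_eq_intros pohozaev_deriv
          simp: field_simps power2_eq_square power3_eq_cube)
    moreover have "(- 2 * (y\<^sup>2 * potential y + (pohozaev y + K))) / y ^ 3 \<le> 0"
      using ge[OF y] y by (intro divide_nonpos_pos) auto
    ultimately show "\<exists>z. ((\<lambda>r. (pohozaev r + K) / r\<^sup>2) has_real_derivative z) (at y) \<and> z \<le> 0"
      by blast
  qed
  define c where "c = - ((pohozaev x + K) / x\<^sup>2)"
  have "c > 0" using neg x by (simp add: c_def divide_neg_pos)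
  then have "eventually (\<lambda>r. potential r < c \<and> r \<ge> x) at_top"
    by (intro eventually_conj order_tendstoD(2)[OF potential_tendsto_0] eventually_ge_at_top)
  then obtain r where r: "potential r < c" "r \<ge> x"
    using eventually_happens'[OF trivial_limit_at_top_linorder] by blast
  have "- potential r \<le> (pohozaev r + K) / r\<^sup>2"
    using ge[of r] r(2) x by (simp add: field_simps)
  also have "\<dots> \<le> - c" using dec[OF r(2)] by (simp add: c_def)
  finally show False using r by simp
qed

lemma pohozaev_antimono:
  assumes "0 < x" "x \<le> y"
  shows "pohozaev y \<le> pohozaev x"
proof (rule DERIV_nonpos_imp_nonincreasing[OF assms(2)])
  fix z assume "x \<le> z" "z \<le> y"
  then have "z > 0" using assms by simp
  moreover have "- 2 * z * potential z \<le> 0"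
    using \<open>z > 0\<close> potential_nonneg[of z] by (simp add: mult_nonneg_nonneg)
  ultimately show "\<exists>d. (pohozaev has_real_derivative d) (at z) \<and> d \<le> 0"
    using pohozaev_deriv by blast
qed

text \<open>Monotonicity reduces this to \<open>r = 1\<close>, the first point covered by the
  interior estimate; there the negative terms are discarded.\<close>

lemma pohozaev_le:
  assumes "r \<ge> 1"
  shows "pohozaev r \<le> slope\<^sup>2"
proof -
  have "(deriv f 1)\<^sup>2 \<le> slope\<^sup>2" "(deriv g 1)\<^sup>2 \<le> slope\<^sup>2"
    using slope_bound[of 1] by (auto simp: abs_le_square_iff[symmetric])
  moreover have "(of_int n1)\<^sup>2 * (f 1)\<^sup>2 \<ge> 0" "(of_int n2)\<^sup>2 * (g 1)\<^sup>2 \<ge> 0" by auto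
  ultimately have "pohozaev 1 \<le> slope\<^sup>2"
    using potential_nonneg[of 1] unfolding pohozaev_def mult_1 one_power2 by argo
  then show ?thesis using pohozaev_antimono[of 1 r] assms by simp
qed

lemma potential_slope_bound:
  assumes "r \<ge> 1"
  shows "\<bar>potential' r\<bar> \<le> potential_slope"
proof -
  have r: "r > 0" using assms by simp
  have p: "0 \<le> (A1 + A2 + B0) * mass" using A1 A2 B0 mass_gt by simp
  have s: "slope \<ge> 0" using slope_bound[OF assms] by linarith
  have "\<bar>f r * deriv f r\<bar> \<le> mass * slope" "\<bar>g r * deriv g r\<bar> \<le> mass * slope"
    unfolding abs_mult using values_bound[OF r] slope_bound[OF assms] mass_gt s
    by (auto intro!: mult_mono)
  then have "\<bar>(A1 * ((f r)\<^sup>2 - t1\<^sup>2) + B * ((g r)\<^sup>2 - t2\<^sup>2)) * (f r * deriv f r)\<bar>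
      \<le> (A1 + A2 + B0) * mass * (mass * slope)"
    "\<bar>(A2 * ((g r)\<^sup>2 - t2\<^sup>2) + B * ((f r)\<^sup>2 - t1\<^sup>2)) * (g r * deriv g r)\<bar>
      \<le> (A1 + A2 + B0) * mass * (mass * slope)"
    unfolding abs_mult[of "_ + _"] using nonlinearity_bound[OF r] p by (auto intro!: mult_mono)
  then show ?thesis unfolding potential'_def potential_slope_def by (simp add: algebra_simps)
qed

lemma potential_small:
  assumes e: "e > 0" and x: "x \<ge> settling_radius e"
  shows "potential x \<le> e"
proof (rule ccontr)
  assume "\<not> potential x \<le> e"
  then have gt: "potential x > e" by simp
  define L where "L = potential_slope + 1"
  have "potential_slope \<ge> 0" using potential_slope_bound[of 1] by simp
  then have L: "L > 0" by (simp add: L_def)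
  have c0: "centrifugal \<ge> 0" using mass_gt by (simp add: centrifugal_def)
  have x1: "x \<ge> 1"
    using x L c0 unfolding settling_radius_def L_def[symmetric]
    by (smt (verit) divide_nonneg_nonneg mult_nonneg_nonneg zero_le_power2)
  \<comment> \<open>Over this length the potential changes by at most \<open>e / 2\<close>.\<close>
  define d where "d = e / (2 * L)"
  have d: "d > 0" using e L by (simp add: d_def)
  have "\<exists>z>x. z < x + d \<and> pohozaev (x + d) - pohozaev x = (x + d - x) * (- 2 * z * potential z)"
    using d x1 by (intro MVT2 pohozaev_deriv) auto
  then obtain z where z: "x < z" "z < x + d"
    "pohozaev (x + d) - pohozaev x = d * (- 2 * z * potential z)" by auto
  have "\<exists>y>x. y < z \<and> potential z - potential x = (z - x) * potential' y"
    using z x1 by (intro MVT2 potential_deriv) auto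
  then obtain y where y: "x < y" "y < z" "potential z - potential x = (z - x) * potential' y"
    by auto
  have "\<bar>potential z - potential x\<bar> \<le> d * L"
    unfolding y(3) abs_mult using y z x1 potential_slope_bound[of y] d
    by (intro mult_mono) (auto simp: L_def)
  also have "\<dots> = e / 2" using L by (simp add: d_def)
  finally have Vz: "potential z > e / 2" using gt by linarith
  have "d * (x * e) = d * (2 * x * (e / 2))" by simp
  also have "\<dots> < d * (2 * z * potential z)"
    using d z x1 Vz e by (intro mult_strict_left_mono mult_strict_mono) auto
  also have "\<dots> = pohozaev x - pohozaev (x + d)" using z(3) by simp
  also have "\<dots> \<le> slope\<^sup>2 + centrifugal"
    using pohozaev_le[OF x1] pohozaev_ge[of "x + d"] d x1 c0 by simp
  finally have "x * e\<^sup>2 < (slope\<^sup>2 + centrifugal) * (2 * L)"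
    using L by (simp add: d_def field_simps power2_eq_square)
  then have "x < (slope\<^sup>2 + centrifugal) * (2 * L) / e\<^sup>2"
    using e by (simp add: field_simps)
  then show False using x by (simp add: settling_radius_def L_def)
qed

end

lemma (in radial_parameters) uniform_convergence:
  assumes e: "e > 0"
  obtains R where "R \<ge> 1" "\<And>B f g r. radial_pair A1 A2 t1 t2 n1 n2 B0 B f g \<Longrightarrow> r \<ge> R \<Longrightarrow>
    \<bar>f r - t1\<bar> \<le> e \<and> \<bar>g r - t2\<bar> \<le> e"
proof -
  \<comment> \<open>With \<open>potential <= m\<close> one has
    \<open>|f^2 - t1^2| <= t1 * e\<close>, and likewise for \<open>g\<close>; the factor
    \<open>f + t1 >= t1\<close> can then be divided out.\<close>
  define m where "m = ell * (min t1 t2 * e)\<^sup>2 / 4"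
  have m: "m > 0" using ell_pos t1 t2 e by (simp add: m_def)
  have "\<bar>f r - t1\<bar> \<le> e \<and> \<bar>g r - t2\<bar> \<le> e"
    if pair: "radial_pair A1 A2 t1 t2 n1 n2 B0 B f g" and r: "r \<ge> max 1 (settling_radius m)"
    for B f g r
  proof -
    interpret radial_pair A1 A2 t1 t2 n1 n2 B0 B f g by (rule pair)
    have "ell * (((f r)\<^sup>2 - t1\<^sup>2)\<^sup>2 + ((g r)\<^sup>2 - t2\<^sup>2)\<^sup>2) \<le> ell * (min t1 t2 * e)\<^sup>2"
      using potential_ge[of r] potential_small[OF m, of r] r by (simp add: m_def)
    then have "((f r)\<^sup>2 - t1\<^sup>2)\<^sup>2 + ((g r)\<^sup>2 - t2\<^sup>2)\<^sup>2 \<le> (min t1 t2 * e)\<^sup>2"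
      using ell_pos by simp
    then have "((f r)\<^sup>2 - t1\<^sup>2)\<^sup>2 \<le> (min t1 t2 * e)\<^sup>2" "((g r)\<^sup>2 - t2\<^sup>2)\<^sup>2 \<le> (min t1 t2 * e)\<^sup>2"
      using zero_le_power2[of "(f r)\<^sup>2 - t1\<^sup>2"] zero_le_power2[of "(g r)\<^sup>2 - t2\<^sup>2"] by linarith+
    then have "\<bar>(f r)\<^sup>2 - t1\<^sup>2\<bar> \<le> min t1 t2 * e" "\<bar>(g r)\<^sup>2 - t2\<^sup>2\<bar> \<le> min t1 t2 * e"
      using t1 t2 e by (auto simp: abs_le_square_iff[symmetric])
    moreover have "min t1 t2 * e \<le> t1 * e" "min t1 t2 * e \<le> t2 * e"
      using e by (auto intro!: mult_right_mono)
    ultimately have *: "\<bar>(f r)\<^sup>2 - t1\<^sup>2\<bar> \<le> t1 * e" "\<bar>(g r)\<^sup>2 - t2\<^sup>2\<bar> \<le> t2 * e" by linarith+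
    have close: "\<bar>y - t\<bar> \<le> e" if "\<bar>y\<^sup>2 - t\<^sup>2\<bar> \<le> t * e" "y \<ge> 0" "t > 0" for y t :: real
    proof -
      have "t * \<bar>y - t\<bar> \<le> (y + t) * \<bar>y - t\<bar>" using that by (intro mult_right_mono) auto
      also have "\<dots> = \<bar>(y + t) * (y - t)\<bar>" using that by (simp add: abs_mult)
      also have "\<dots> = \<bar>y\<^sup>2 - t\<^sup>2\<bar>" by (simp add: power2_eq_square algebra_simps)
      finally show ?thesis using that by (meson dual_order.trans mult_le_cancel_left_pos)
    qed
    show ?thesis using close[OF *(1)] close[OF *(2)] nonneg[of r] r t1 t2 by auto
  qed
  then show ?thesis using that[of "max 1 (settling_radius m)"] by simp
qed

section \<open>Algebra of the truncated expansion and its defect in the equations\<close>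

subsection \<open>The formal expansion\<close>

lemma times_coeff_a:
  assumes "t \<noteq> 0"
  shows "t * coeff_a A A' B t n n' = (B * (of_int n')\<^sup>2 - A' * (of_int n)\<^sup>2) / (2 * (A * A' - B\<^sup>2))"
  using assms by (simp add: coeff_a_def)

text \<open>The conditions for the terms of order \<open>r\<^sup>-\<^sup>2\<close> and \<open>r\<^sup>-\<^sup>4\<close> of the equation divided by \<open>f\<close> to
  vanish.\<close>

lemma coeff_order2:
  assumes "t \<noteq> 0" "s \<noteq> 0" and D: "A * A' - B\<^sup>2 \<noteq> 0"
  shows "(of_int n)\<^sup>2 + 2 * A * t * coeff_a A A' B t n n' + 2 * B * s * coeff_a A' A B s n' n = 0"
proof -
  have "(of_int n)\<^sup>2 + 2 * A * (t * coeff_a A A' B t n n') + 2 * B * (s * coeff_a A' A B s n' n)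
     = (of_int n)\<^sup>2 + (A * (B * (of_int n')\<^sup>2 - A' * (of_int n)\<^sup>2)
        + B * (B * (of_int n)\<^sup>2 - A * (of_int n')\<^sup>2)) / (A * A' - B\<^sup>2)"
    unfolding times_coeff_a[OF assms(1)] times_coeff_a[OF assms(2)] mult.commute[of A' A]
    using D by (simp add: divide_simps) (simp add: algebra_simps)
  also have "\<dots> = 0" using D by (simp add: field_simps power2_eq_square)
  finally show ?thesis by (simp add: mult.assoc)
qed

text \<open>\<open>a^2 + 2 t b\<close> is the coefficient of \<open>r^-4\<close> in the square of
  the expansion. The two such coefficients solve a linear system with matrix rows
  \<open>(A, B)\<close>, \<open>(B, A')\<close> and right-hand sides \<open>4 a / t\<close>,
  \<open>4 a' / s\<close>; this is Cramer's rule for it.\<close>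

lemma coeff_a_b:
  fixes A A' B t s :: real
  assumes "t \<noteq> 0" "s \<noteq> 0" and D: "A * A' - B\<^sup>2 \<noteq> 0"
  shows "(coeff_a A A' B t n n')\<^sup>2 + 2 * t * coeff_b A A' B t s n n'
    = 4 * (A' * (coeff_a A A' B t n n' / t) - B * (coeff_a A' A B s n' n / s)) / (A * A' - B\<^sup>2)"
proof -
  obtain N N' D where N: "N = (of_int n :: real)" "N' = (of_int n' :: real)" "D = A * A' - B\<^sup>2"
    by blast
  have D: "D \<noteq> 0" using D N by simp
  have D': "A' * A - B\<^sup>2 = D" using N by (simp add: mult.commute)
  show ?thesis unfolding coeff_a_def coeff_b_def D' N[symmetric]
    using assms(1,2) D
    by (simp add: divide_simps) (simp add: power2_eq_square power3_eq_cube power4_eq_xxxx eval_nat_numeral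
      algebra_simps)
qed

lemma coeff_order4:
  fixes A A' B t s :: real
  assumes "t \<noteq> 0" "s \<noteq> 0" and D: "A * A' - B\<^sup>2 \<noteq> 0"
  shows "A * ((coeff_a A A' B t n n')\<^sup>2 + 2 * t * coeff_b A A' B t s n n')
    + B * ((coeff_a A' A B s n' n)\<^sup>2 + 2 * s * coeff_b A' A B s t n' n) = 4 * coeff_a A A' B t n n' / t"
proof -
  define u v where "u = coeff_a A A' B t n n' / t" and "v = coeff_a A' A B s n' n / s"
  \<comment> \<open>Substituting Cramer's formulas back: the terms in \<open>v\<close> cancel and
    the determinant factors out.\<close>
  have uv: "A * (4 * (A' * u - B * v)) + B * (4 * (A * v - B * u)) = 4 * u * (A * A' - B\<^sup>2)"
    by (simp add: power2_eq_square algebra_simps)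
  have D': "A' * A - B\<^sup>2 \<noteq> 0" using D by (simp add: mult.commute)
  show ?thesis
    unfolding coeff_a_b[OF assms] coeff_a_b[OF assms(2,1) D'] mult.commute[of A' A]
    using D uv unfolding u_def[symmetric] v_def[symmetric] times_divide_eq_right add_divide_distrib[symmetric]
    by (simp add: u_def)
qed

definition profile :: "real \<Rightarrow> real \<Rightarrow> real \<Rightarrow> real \<Rightarrow> real" where
  "profile t a b r = t + a / r^2 + b / r^4"

text \<open>The factor in the equation: a component \<open>y\<close> with partner \<open>z\<close>
  satisfies \<open>y'' + y' / r = rate * y\<close>. Taking values as arguments lets it apply to the
  solution and to the profile.\<close>

definition rate :: "real \<Rightarrow> real \<Rightarrow> real \<Rightarrow> real \<Rightarrow> int \<Rightarrow> real \<Rightarrow> real \<Rightarrow> real \<Rightarrow> real" where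
  "rate A B t s n y z r = (of_int n)\<^sup>2 / r\<^sup>2 + A * (y\<^sup>2 - t\<^sup>2) + B * (z\<^sup>2 - s\<^sup>2)"

lemma profile_deriv:
  assumes "r > 0"
  shows "(profile t a b has_real_derivative - (2 * a / r^3) - 4 * b / r^5) (at r)"
    and "((\<lambda>r. - (2 * a / r^3) - 4 * b / r^5) has_real_derivative 6 * a / r^4 + 20 * b / r^6) (at r)"
  unfolding profile_def[abs_def] using assms
  by (auto intro!: derivative_eq_intros) (simp_all add: field_simps eval_nat_numeral)

lemma profile_tendsto: "(profile t a b \<longlongrightarrow> t) at_top"
proof -
  have "((\<lambda>r. c / r ^ k) \<longlongrightarrow> 0) at_top" if "k > 0" for c :: real and k
    using that by (intro tendsto_divide_0[OF tendsto_const] filterlim_at_top_imp_at_infinity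
        filterlim_pow_at_top filterlim_ident)
  then have "(profile t a b \<longlongrightarrow> t + 0 + 0) at_top"
    unfolding profile_def[abs_def] by (intro tendsto_intros) auto
  then show ?thesis by simp
qed

text \<open>\<open>x\<close> stands for \<open>1 / r^2\<close>. The hypotheses remove order
  \<open>x\<close> and fix order \<open>x^2\<close>; \<open>w\<close> collects the rest. In the
  second identity \<open>4 a x^2 + 16 b x^3\<close> is the radial Laplacian of the profile, whose
  leading term cancels against \<open>4 a / t\<close> times the constant \<open>t\<close> of
  \<open>p\<close>.\<close>

lemma profile_rate_expansion:
  fixes A B t s a b a' b' N x :: real
  assumes e2: "N\<^sup>2 + 2 * A * t * a + 2 * B * s * a' = 0"
    and e4: "A * (a\<^sup>2 + 2 * t * b) + B * (a'\<^sup>2 + 2 * s * b') = 4 * a / t" and t: "t \<noteq> 0"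
  defines "w \<equiv> A * (2 * a * b + b\<^sup>2 * x) + B * (2 * a' * b' + b'\<^sup>2 * x)"
    and "p \<equiv> t + a * x + b * x\<^sup>2" and "q \<equiv> s + a' * x + b' * x\<^sup>2"
  shows "N\<^sup>2 * x + A * (p\<^sup>2 - t\<^sup>2) + B * (q\<^sup>2 - s\<^sup>2) = x\<^sup>2 * (4 * a / t + x * w)"
    and "4 * a * x\<^sup>2 + 16 * b * x^3 - (N\<^sup>2 * x + A * (p\<^sup>2 - t\<^sup>2) + B * (q\<^sup>2 - s\<^sup>2)) * p
      = x^3 * (16 * b - 4 * a / t * (a + b * x) - w * p)"
proof -
  have "N\<^sup>2 * x + A * (p\<^sup>2 - t\<^sup>2) + B * (q\<^sup>2 - s\<^sup>2)
      = x * (N\<^sup>2 + 2 * A * t * a + 2 * B * s * a')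
      + x\<^sup>2 * (A * (a\<^sup>2 + 2 * t * b) + B * (a'\<^sup>2 + 2 * s * b')) + x^3 * w"
    unfolding p_def q_def w_def by (simp add: power2_eq_square power3_eq_cube algebra_simps)
  then show 1: "N\<^sup>2 * x + A * (p\<^sup>2 - t\<^sup>2) + B * (q\<^sup>2 - s\<^sup>2) = x\<^sup>2 * (4 * a / t + x * w)"
    unfolding e2 e4 by (simp add: power2_eq_square power3_eq_cube algebra_simps)
  define k where "k = 4 * a / t"
  have k: "4 * a = k * t" using t by (simp add: k_def)
  show "4 * a * x\<^sup>2 + 16 * b * x^3 - (N\<^sup>2 * x + A * (p\<^sup>2 - t\<^sup>2) + B * (q\<^sup>2 - s\<^sup>2)) * p
      = x^3 * (16 * b - 4 * a / t * (a + b * x) - w * p)"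
    unfolding 1 k_def[symmetric] unfolding k p_def
    by (simp add: power2_eq_square power3_eq_cube algebra_simps)
qed

text \<open>\<open>p\<close> and \<open>q\<close> approximate \<open>y\<close> and \<open>z\<close>,
  and \<open>e\<close> is the defect of \<open>p\<close>. Factoring the differences of squares gives
  an exact relation, linear in the deviations, whose coefficients still contain the
  solution.\<close>

lemma laplacian_difference:
  "rate A B t s n y z r * y - (rate A B t s n p q r * p + e)
    = rate A B t s n p q r * (y - p) + A * (y * (y + p)) * (y - p) + B * (y * (z + q)) * (z - q) - e"
  by (simp add: rate_def power2_eq_square algebra_simps diff_divide_distrib)

text \<open>These products are the coefficients in the deviation system; \<open>2 * t * s\<close> is
  their value for the linearization at the limits.\<close>

lemma product_close:
  fixes y z q t s e :: real
  assumes "\<bar>y - t\<bar> \<le> e" "\<bar>z - s\<bar> \<le> e" "\<bar>q - s\<bar> \<le> e" and e: "e \<le> 1" and t: "t > 0" and s: "s > 0"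
  shows "\<bar>y * (z + q) - 2 * t * s\<bar> \<le> (2 * s + 2 + 2 * t) * e"
proof -
  have "\<bar>(y - t) * (z + q)\<bar> \<le> e * (2 * s + 2)"
    unfolding abs_mult using assms by (intro mult_mono) auto
  moreover have "\<bar>t * ((z - s) + (q - s))\<bar> \<le> t * (2 * e)"
    unfolding abs_mult using assms by (intro mult_mono) auto
  moreover have "y * (z + q) - 2 * t * s = (y - t) * (z + q) + t * ((z - s) + (q - s))"
    by (simp add: algebra_simps)
  ultimately show ?thesis by (simp add: algebra_simps)
qed

section \<open>Profile estimates and coercivity, uniform in the coupling\<close>

context radial_parameters
begin

text \<open>Estimates proved for the first component become available for the second.\<close>

lemma swapped: "radial_parameters A2 A1 t2 t1 B0"
  using A1 A2 t1 t2 B0 det by unfold_locales (auto simp: mult.commute)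

lemma det_pos: "A1 * A2 - B\<^sup>2 > 0" if "\<bar>B\<bar> \<le> B0"
proof -
  have "B\<^sup>2 \<le> B0\<^sup>2" using that B0 by (simp add: abs_le_square_iff[symmetric])
  with det show ?thesis by simp
qed

definition "a1 B = coeff_a A1 A2 B t1 n1 n2"
definition "a2 B = coeff_a A2 A1 B t2 n2 n1"
definition "b1 B = coeff_b A1 A2 B t1 t2 n1 n2"
definition "b2 B = coeff_b A2 A1 B t2 t1 n2 n1"

definition "p1 B = profile t1 (a1 B) (b1 B)"
definition "p2 B = profile t2 (a2 B) (b2 B)"

lemma coeff_continuous: "continuous_on {-B0..B0} a1" "continuous_on {-B0..B0} b1"
proof -
  have "A1 * A2 - B\<^sup>2 \<noteq> 0" if "B \<in> {-B0..B0}" for B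
    using det_pos[of B] that by (auto simp: abs_le_iff)
  then show "continuous_on {-B0..B0} a1" "continuous_on {-B0..B0} b1"
    unfolding a1_def[abs_def] b1_def[abs_def] coeff_a_def coeff_b_def
    using t1 t2 by (auto intro!: continuous_intros)
qed

text \<open>In the variable \<open>x = 1 / r\<^sup>2\<close> all remainders are continuous functions of \<open>(B, x)\<close> on a compact
  rectangle, up to powers of \<open>x\<close>.\<close>

lemma half_profile_estimates:
  obtains C where "C > 0" "\<And>B r. \<bar>B\<bar> \<le> B0 \<Longrightarrow> r \<ge> 1 \<Longrightarrow>
    \<bar>p1 B r - t1\<bar> \<le> C / r^2 \<and> \<bar>rate A1 B t1 t2 n1 (p1 B r) (p2 B r) r\<bar> \<le> C / r^4 \<and>
    \<bar>4 * a1 B / r^4 + 16 * b1 B / r^6 - rate A1 B t1 t2 n1 (p1 B r) (p2 B r) r * p1 B r\<bar> \<le> C / r^6 \<and>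
    4 * \<bar>b1 B\<bar> \<le> C"
proof -
  \<comment> \<open>\<open>F1\<close>, \<open>F2\<close>, \<open>F3\<close> are the remainders of
    the three estimates with the powers \<open>x\<close>, \<open>x^2\<close>, \<open>x^3\<close>
    divided out; \<open>F\<close> adds absolute values so that one bound serves all.\<close>
  define w where "w z = A1 * (2 * a1 (fst z) * b1 (fst z) + (b1 (fst z))\<^sup>2 * snd z)
    + fst z * (2 * a2 (fst z) * b2 (fst z) + (b2 (fst z))\<^sup>2 * snd z)" for z
  define F1 where "F1 z = a1 (fst z) + b1 (fst z) * snd z" for z
  define F2 where "F2 z = 4 * a1 (fst z) / t1 + snd z * w z" for z
  define F3 where "F3 z = 16 * b1 (fst z) - 4 * a1 (fst z) / t1 * (a1 (fst z) + b1 (fst z) * snd z)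
    - w z * (t1 + a1 (fst z) * snd z + b1 (fst z) * (snd z)\<^sup>2)" for z
  define F where "F z = \<bar>F1 z\<bar> + \<bar>F2 z\<bar> + \<bar>F3 z\<bar> + 4 * \<bar>b1 (fst z)\<bar>" for z
  let ?K = "{-B0..B0} \<times> {0..1::real}"
  interpret swap: radial_parameters A2 A1 t2 t1 n2 n1 B0 by (rule swapped)
  have sw: "swap.a1 = a2" "swap.b1 = b2"
    by (auto simp: swap.a1_def swap.b1_def a2_def b2_def)
  note conts = coeff_continuous swap.coeff_continuous[unfolded sw]
  have cf: "continuous_on ?K (\<lambda>z. c (fst z))" if "continuous_on {-B0..B0} c" for c :: "real \<Rightarrow> real"
    by (rule continuous_on_compose2[OF that continuous_on_fst[OF continuous_on_id]]) auto
  have wc: "continuous_on ?K w" unfolding w_def[abs_def]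
    by (intro continuous_intros cf conts)
  have "continuous_on ?K F" unfolding F_def F1_def F2_def F3_def
    using t1 by (intro continuous_intros cf conts wc) auto
  then have "compact (F ` ?K)"
    by (intro compact_continuous_image compact_Times) auto
  then obtain C where C: "\<And>z. z \<in> ?K \<Longrightarrow> F z \<le> C"
    using bounded_imp_bdd_above[OF compact_imp_bounded] by (fastforce simp: bdd_above_def)
  show ?thesis
  proof (rule that[of "max C 1"])
    show "max C 1 > 0" by simp
    fix B r :: real assume B: "\<bar>B\<bar> \<le> B0" and r: "r \<ge> 1"
    define x where "x = 1 / r\<^sup>2"
    have pw: "1 / r\<^sup>2 = x" "1 / r^4 = x\<^sup>2" "1 / r^6 = x^3"
      by (auto simp: x_def power_divide power_mult[symmetric])
    have "r\<^sup>2 \<ge> 1" using r by simp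
    then have x: "0 \<le> x" "x \<le> 1" using r by (auto simp: x_def divide_le_eq_1)
    have "F (B, x) \<le> max C 1" using C[of "(B, x)"] B x by (auto simp: le_max_iff_disj abs_le_iff)
    then have Fs: "\<bar>F1 (B, x)\<bar> \<le> max C 1" "\<bar>F2 (B, x)\<bar> \<le> max C 1" "\<bar>F3 (B, x)\<bar> \<le> max C 1"
      "4 * \<bar>b1 B\<bar> \<le> max C 1" unfolding F_def fst_conv by linarith+
    have dv: "c / r\<^sup>2 = c * x" "c / r^4 = c * x\<^sup>2" "c / r^6 = c * x^3" for c
      using pw by (metis mult.right_neutral times_divide_eq_right)+
    have D: "A1 * A2 - B\<^sup>2 \<noteq> 0" using det_pos[OF B] by simp
    have p: "p1 B r = t1 + a1 B * x + b1 B * x\<^sup>2" "p2 B r = t2 + a2 B * x + b2 B * x\<^sup>2"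
      by (auto simp: p1_def p2_def profile_def dv)
    have nz: "t1 \<noteq> 0" "t2 \<noteq> 0" using t1 t2 by auto
    have e: "(of_int n1)\<^sup>2 + 2 * A1 * t1 * a1 B + 2 * B * t2 * a2 B = 0"
      "A1 * ((a1 B)\<^sup>2 + 2 * t1 * b1 B) + B * ((a2 B)\<^sup>2 + 2 * t2 * b2 B) = 4 * a1 B / t1"
      unfolding a1_def a2_def b1_def b2_def
      using coeff_order2[OF nz D] coeff_order4[OF nz D] by auto
    note ex = profile_rate_expansion[OF e nz(1), of x, folded p]
    have "p1 B r - t1 = F1 (B, x) * x"
      by (simp add: p F1_def power2_eq_square algebra_simps)
    then have 1: "\<bar>p1 B r - t1\<bar> \<le> max C 1 / r\<^sup>2"
      unfolding dv using x Fs by (simp add: abs_mult mult_right_mono)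
    have rt: "rate A1 B t1 t2 n1 (p1 B r) (p2 B r) r
        = (of_int n1)\<^sup>2 * x + A1 * ((p1 B r)\<^sup>2 - t1\<^sup>2) + B * ((p2 B r)\<^sup>2 - t2\<^sup>2)"
      by (simp add: rate_def dv)
    have "rate A1 B t1 t2 n1 (p1 B r) (p2 B r) r = F2 (B, x) * x\<^sup>2"
      unfolding rt ex(1) by (simp add: F2_def w_def)
    then have 2: "\<bar>rate A1 B t1 t2 n1 (p1 B r) (p2 B r) r\<bar> \<le> max C 1 / r^4"
      unfolding dv using x Fs by (simp add: abs_mult mult_right_mono)
    have "4 * a1 B * x\<^sup>2 + 16 * b1 B * x^3 - rate A1 B t1 t2 n1 (p1 B r) (p2 B r) r * p1 B r
        = F3 (B, x) * x^3"
      unfolding rt ex(2) by (simp add: F3_def w_def p)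
    then have 3: "\<bar>4 * a1 B / r^4 + 16 * b1 B / r^6 - rate A1 B t1 t2 n1 (p1 B r) (p2 B r) r * p1 B r\<bar>
        \<le> max C 1 / r^6"
      unfolding dv using x Fs by (simp add: abs_mult mult_right_mono)
    from 1 2 3 Fs(4) show "\<bar>p1 B r - t1\<bar> \<le> max C 1 / r^2 \<and>
      \<bar>rate A1 B t1 t2 n1 (p1 B r) (p2 B r) r\<bar> \<le> max C 1 / r^4 \<and>
      \<bar>4 * a1 B / r^4 + 16 * b1 B / r^6 - rate A1 B t1 t2 n1 (p1 B r) (p2 B r) r * p1 B r\<bar>
        \<le> max C 1 / r^6 \<and> 4 * \<bar>b1 B\<bar> \<le> max C 1" by blast
  qed
qed

text \<open>Half a coercivity constant of the linearization at \<open>(t1, t2)\<close>.\<close>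

definition "gap = ell * (min t1 t2)\<^sup>2"

lemma gap_pos: "gap > 0" using ell_pos t1 t2 by (simp add: gap_def)

text \<open>The linearized form contributes \<open>2 * gap\<close>. Perturbing the coefficients by
  \<open>h\<close> costs \<open>gap / 4\<close>, the rates another \<open>gap / 4\<close>, and
  Young's inequality for the source terms \<open>gap / 2\<close>; what is left is
  \<open>gap\<close>.\<close>

lemma perturbed_form_ge:
  fixes P11 P12 P21 P22 x y :: real
  assumes B: "\<bar>B\<bar> \<le> B0"
    and P: "\<bar>P11 - 2 * t1 * t1\<bar> \<le> h" "\<bar>P12 - 2 * t1 * t2\<bar> \<le> h"
      "\<bar>P21 - 2 * t2 * t1\<bar> \<le> h" "\<bar>P22 - 2 * t2 * t2\<bar> \<le> h"
    and k: "\<bar>k1\<bar> \<le> gap / 4" "\<bar>k2\<bar> \<le> gap / 4" and h: "h * (A1 + A2 + B0) \<le> gap / 4"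
    and e: "\<bar>e1\<bar> \<le> d" "\<bar>e2\<bar> \<le> d"
  shows "gap * (x\<^sup>2 + y\<^sup>2) - d\<^sup>2 / gap
    \<le> x * (k1 * x + A1 * P11 * x + B * P12 * y - e1) + y * (k2 * y + A2 * P22 * y + B * P21 * x - e2)"
proof -
  have h0: "h \<ge> 0" using P(1) by linarith
  have "gap * (x\<^sup>2 + y\<^sup>2) \<le> ell * ((t1 * x)\<^sup>2 + (t2 * y)\<^sup>2)"
  proof -
    have "(min t1 t2)\<^sup>2 * x\<^sup>2 \<le> t1\<^sup>2 * x\<^sup>2" "(min t1 t2)\<^sup>2 * y\<^sup>2 \<le> t2\<^sup>2 * y\<^sup>2"
      using t1 t2 by (auto intro!: mult_right_mono power_mono)
    then have "(min t1 t2)\<^sup>2 * (x\<^sup>2 + y\<^sup>2) \<le> (t1 * x)\<^sup>2 + (t2 * y)\<^sup>2"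
      by (simp add: power_mult_distrib algebra_simps)
    then show ?thesis unfolding gap_def mult.assoc using ell_pos by (intro mult_left_mono) auto
  qed
  also have "\<dots> \<le> A1 * (t1 * x)\<^sup>2 + 2 * B * (t1 * x) * (t2 * y) + A2 * (t2 * y)\<^sup>2"
    by (rule form_ge[OF B])
  finally have main: "2 * gap * (x\<^sup>2 + y\<^sup>2)
      \<le> A1 * (2 * t1 * t1) * x\<^sup>2 + B * (2 * t1 * t2) * (x * y)
        + B * (2 * t2 * t1) * (x * y) + A2 * (2 * t2 * t2) * y\<^sup>2"
    by (simp add: power2_eq_square algebra_simps)
  have "2 * \<bar>x * y\<bar> \<le> x\<^sup>2 + y\<^sup>2"
    using sum_squares_bound[of "\<bar>x\<bar>" "\<bar>y\<bar>"] by (simp add: abs_mult)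
  then have "(B0 * h) * (2 * \<bar>x * y\<bar>) \<le> (B0 * h) * (x\<^sup>2 + y\<^sup>2)"
    using B0 h0 by (intro mult_left_mono) auto
  moreover have "\<bar>B * (P12 - 2 * t1 * t2) * (x * y)\<bar> \<le> B0 * h * \<bar>x * y\<bar>"
    "\<bar>B * (P21 - 2 * t2 * t1) * (x * y)\<bar> \<le> B0 * h * \<bar>x * y\<bar>"
    unfolding abs_mult using B P B0 h0 by (auto intro!: mult_mono)
  moreover have "\<bar>A1 * (P11 - 2 * t1 * t1) * x\<^sup>2\<bar> \<le> A1 * h * x\<^sup>2"
    "\<bar>A2 * (P22 - 2 * t2 * t2) * y\<^sup>2\<bar> \<le> A2 * h * y\<^sup>2"
    unfolding abs_mult using A1 A2 P h0 by (auto intro!: mult_mono)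
  moreover have "A1 * h * x\<^sup>2 \<le> A1 * h * (x\<^sup>2 + y\<^sup>2)" "A2 * h * y\<^sup>2 \<le> A2 * h * (x\<^sup>2 + y\<^sup>2)"
    using A1 A2 h0 by (auto intro!: mult_left_mono)
  moreover have "h * (A1 + A2 + B0) * (x\<^sup>2 + y\<^sup>2) \<le> gap / 4 * (x\<^sup>2 + y\<^sup>2)"
    using h by (intro mult_right_mono) auto
  moreover have "h * (A1 + A2 + B0) * (x\<^sup>2 + y\<^sup>2)
      = A1 * h * (x\<^sup>2 + y\<^sup>2) + A2 * h * (x\<^sup>2 + y\<^sup>2) + B0 * h * (x\<^sup>2 + y\<^sup>2)"
    by (simp add: algebra_simps)
  ultimately have pert: "A1 * (P11 - 2 * t1 * t1) * x\<^sup>2 + B * (P12 - 2 * t1 * t2) * (x * y)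
      + B * (P21 - 2 * t2 * t1) * (x * y) + A2 * (P22 - 2 * t2 * t2) * y\<^sup>2 \<ge> - (gap / 4 * (x\<^sup>2 + y\<^sup>2))"
    unfolding abs_le_iff by linarith
  have "- (gap / 4) \<le> k1" "- (gap / 4) \<le> k2" using k by linarith+
  then have "- (gap / 4) * x\<^sup>2 \<le> k1 * x\<^sup>2" "- (gap / 4) * y\<^sup>2 \<le> k2 * y\<^sup>2"
    by (simp_all only: mult_right_mono zero_le_power2)
  then have rates: "k1 * x\<^sup>2 + k2 * y\<^sup>2 \<ge> - (gap / 4 * (x\<^sup>2 + y\<^sup>2))"
    unfolding distrib_left by linarith
  have young: "u * c \<le> gap / 2 * u\<^sup>2 + d\<^sup>2 / (2 * gap)" if "\<bar>c\<bar> \<le> d" for u c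
  proof -
    have "c\<^sup>2 \<le> d\<^sup>2" using that by (metis abs_le_square_iff abs_of_nonneg abs_ge_zero order_trans)
    moreover have "0 \<le> (gap * u - c)\<^sup>2" by simp
    ultimately have "2 * gap * (u * c) \<le> gap\<^sup>2 * u\<^sup>2 + d\<^sup>2"
      by (simp add: power2_eq_square algebra_simps)
    then show ?thesis using gap_pos by (simp add: field_simps power2_eq_square)
  qed
  have "d\<^sup>2 / (2 * gap) + d\<^sup>2 / (2 * gap) = d\<^sup>2 / gap" by (simp add: field_simps)
  then have src: "x * e1 + y * e2 \<le> gap / 2 * (x\<^sup>2 + y\<^sup>2) + d\<^sup>2 / gap"
    using young[OF e(1), of x] young[OF e(2), of y] by (simp add: algebra_simps)
  have "x * (k1 * x + A1 * P11 * x + B * P12 * y - e1) + y * (k2 * y + A2 * P22 * y + B * P21 * x - e2)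
    = (A1 * (2 * t1 * t1) * x\<^sup>2 + B * (2 * t1 * t2) * (x * y)
        + B * (2 * t2 * t1) * (x * y) + A2 * (2 * t2 * t2) * y\<^sup>2)
      + (A1 * (P11 - 2 * t1 * t1) * x\<^sup>2 + B * (P12 - 2 * t1 * t2) * (x * y)
      + B * (P21 - 2 * t2 * t1) * (x * y) + A2 * (P22 - 2 * t2 * t2) * y\<^sup>2)
      + (k1 * x\<^sup>2 + k2 * y\<^sup>2) - (x * e1 + y * e2)"
    by (simp add: power2_eq_square algebra_simps)
  with main pert rates src show ?thesis by linarith
qed

end

section \<open>Deviation from the expansion: linear system, barrier, derivative bound\<close>

subsection \<open>Comparison with the formal expansion\<close>

context radial_pair
begin

definition "dev1 r = f r - p1 B r"
definition "dev2 r = g r - p2 B r"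
definition "dev1' r = deriv f r + 2 * a1 B / r^3 + 4 * b1 B / r^5"
definition "dev2' r = deriv g r + 2 * a2 B / r^3 + 4 * b2 B / r^5"
definition "dev1'' r = deriv (deriv f) r - 6 * a1 B / r^4 - 20 * b1 B / r^6"
definition "dev2'' r = deriv (deriv g) r - 6 * a2 B / r^4 - 20 * b2 B / r^6"

definition "rate1 r = rate A1 B t1 t2 n1 (p1 B r) (p2 B r) r"
definition "rate2 r = rate A2 B t2 t1 n2 (p2 B r) (p1 B r) r"
text \<open>The first two terms are the radial Laplacian of the profile, so this is its defect in
  the equation.\<close>

definition "residual1 r = 4 * a1 B / r^4 + 16 * b1 B / r^6 - rate1 r * p1 B r"
definition "residual2 r = 4 * a2 B / r^4 + 16 * b2 B / r^6 - rate2 r * p2 B r"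

lemma dev_deriv:
  assumes "r > 0"
  shows "(dev1 has_real_derivative dev1' r) (at r)" "(dev1' has_real_derivative dev1'' r) (at r)"
    and "(dev2 has_real_derivative dev2' r) (at r)" "(dev2' has_real_derivative dev2'' r) (at r)"
proof -
  note P = profile_deriv[OF assms]
  show "(dev1 has_real_derivative dev1' r) (at r)"
    using DERIV_diff[OF f_deriv[OF assms] P(1)[of t1 "a1 B" "b1 B"]]
    by (simp add: dev1_def[abs_def] dev1'_def p1_def algebra_simps)
  show "(dev2 has_real_derivative dev2' r) (at r)"
    using DERIV_diff[OF g_deriv[OF assms] P(1)[of t2 "a2 B" "b2 B"]]
    by (simp add: dev2_def[abs_def] dev2'_def p2_def algebra_simps)
  show "(dev1' has_real_derivative dev1'' r) (at r)"
    using DERIV_diff[OF f_deriv2[OF assms] P(2)[of "a1 B" "b1 B"]]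
    by (simp add: dev1'_def[abs_def] dev1''_def algebra_simps)
  show "(dev2' has_real_derivative dev2'' r) (at r)"
    using DERIV_diff[OF g_deriv2[OF assms] P(2)[of "a2 B" "b2 B"]]
    by (simp add: dev2'_def[abs_def] dev2''_def algebra_simps)
qed

lemma dev_laplacian:
  assumes r: "r > 0"
  shows "dev1'' r + dev1' r / r = rate1 r * dev1 r + A1 * (f r * (f r + p1 B r)) * dev1 r
      + B * (f r * (g r + p2 B r)) * dev2 r - residual1 r"
    and "dev2'' r + dev2' r / r = rate2 r * dev2 r + A2 * (g r * (g r + p2 B r)) * dev2 r
      + B * (g r * (f r + p1 B r)) * dev1 r - residual2 r"
proof -
  have prof: "(u - 6 * a / r^4 - 20 * b / r^6) + (v + 2 * a / r^3 + 4 * b / r^5) / r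
    = (u + v / r) - (4 * a / r^4 + 16 * b / r^6)" for u v a b :: real
    using r by (simp add: field_simps eval_nat_numeral)
  have "dev1'' r + dev1' r / r
      = rate A1 B t1 t2 n1 (f r) (g r) r * f r - (rate1 r * p1 B r + residual1 r)"
    unfolding dev1''_def dev1'_def prof f_eq[OF r] by (simp add: rate_def residual1_def)
  then show "dev1'' r + dev1' r / r = rate1 r * dev1 r + A1 * (f r * (f r + p1 B r)) * dev1 r
      + B * (f r * (g r + p2 B r)) * dev2 r - residual1 r"
    unfolding rate1_def laplacian_difference by (simp add: dev1_def dev2_def)
  have "dev2'' r + dev2' r / r
      = rate A2 B t2 t1 n2 (g r) (f r) r * g r - (rate2 r * p2 B r + residual2 r)"
    unfolding dev2''_def dev2'_def prof g_eq[OF r] by (simp add: rate_def residual2_def)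
  then show "dev2'' r + dev2' r / r = rate2 r * dev2 r + A2 * (g r * (g r + p2 B r)) * dev2 r
      + B * (g r * (f r + p1 B r)) * dev1 r - residual2 r"
    unfolding rate2_def laplacian_difference by (simp add: dev1_def dev2_def)
qed

lemma dev_tendsto_0: "(dev1 \<longlongrightarrow> 0) at_top" "(dev2 \<longlongrightarrow> 0) at_top"
  using tendsto_diff[OF lims(1) profile_tendsto[of t1 "a1 B" "b1 B"]]
    tendsto_diff[OF lims(2) profile_tendsto[of t2 "a2 B" "b2 B"]]
  by (auto simp: dev1_def[abs_def] dev2_def[abs_def] p1_def p2_def)

end

text \<open>Gathers the smallness conditions beyond one radius. The bound on
  \<open>144 / R^2\<close> is for the barrier: the radial Laplacian of \<open>1 / r^12\<close> is
  \<open>144 / r^14\<close>.\<close>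

locale radial_pair_far = radial_pair +
  fixes C e R :: real
  assumes e: "e > 0" "e \<le> 1" "(4 * (t1 + t2) + 2) * e * (A1 + A2 + B0) \<le> gap / 4"
    and R: "R \<ge> 1" "144 / R\<^sup>2 \<le> gap" and C: "C > 0"
    and near: "\<And>r. r \<ge> R \<Longrightarrow> \<bar>f r - t1\<bar> \<le> e \<and> \<bar>g r - t2\<bar> \<le> e \<and> \<bar>p1 B r - t1\<bar> \<le> e \<and> \<bar>p2 B r - t2\<bar> \<le> e"
    and rates: "\<And>r. r \<ge> R \<Longrightarrow> \<bar>rate1 r\<bar> \<le> gap / 4 \<and> \<bar>rate2 r\<bar> \<le> gap / 4"
    and residuals: "\<And>r. r \<ge> R \<Longrightarrow> \<bar>residual1 r\<bar> \<le> C / r^6 \<and> \<bar>residual2 r\<bar> \<le> C / r^6"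
    and b_le: "4 * \<bar>b1 B\<bar> \<le> C" "4 * \<bar>b2 B\<bar> \<le> C"
begin

lemma products_close:
  assumes "r \<ge> R"
  shows "\<bar>f r * (f r + p1 B r) - 2 * t1 * t1\<bar> \<le> (4 * (t1 + t2) + 2) * e"
    "\<bar>f r * (g r + p2 B r) - 2 * t1 * t2\<bar> \<le> (4 * (t1 + t2) + 2) * e"
    "\<bar>g r * (f r + p1 B r) - 2 * t2 * t1\<bar> \<le> (4 * (t1 + t2) + 2) * e"
    "\<bar>g r * (g r + p2 B r) - 2 * t2 * t2\<bar> \<le> (4 * (t1 + t2) + 2) * e"
proof -
  have le: "\<bar>u\<bar> \<le> (2 * s + 2 + 2 * t) * e \<Longrightarrow> t \<in> {t1, t2} \<Longrightarrow> s \<in> {t1, t2}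
      \<Longrightarrow> \<bar>u\<bar> \<le> (4 * (t1 + t2) + 2) * e" for u s t
    using t1 t2 e(1) by (elim order_trans, intro mult_right_mono) auto
  note n = near[OF assms]
  show "\<bar>f r * (f r + p1 B r) - 2 * t1 * t1\<bar> \<le> (4 * (t1 + t2) + 2) * e"
    by (rule le[OF product_close[of _ t1 e _ t1]]) (use n e t1 t2 in auto)
  show "\<bar>f r * (g r + p2 B r) - 2 * t1 * t2\<bar> \<le> (4 * (t1 + t2) + 2) * e"
    by (rule le[OF product_close[of _ t1 e _ t2]]) (use n e t1 t2 in auto)
  show "\<bar>g r * (f r + p1 B r) - 2 * t2 * t1\<bar> \<le> (4 * (t1 + t2) + 2) * e"
    by (rule le[OF product_close[of _ t2 e _ t1]]) (use n e t1 t2 in auto)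
  show "\<bar>g r * (g r + p2 B r) - 2 * t2 * t2\<bar> \<le> (4 * (t1 + t2) + 2) * e"
    by (rule le[OF product_close[of _ t2 e _ t2]]) (use n e t1 t2 in auto)
qed

text \<open>The residual \<open>C / r^6\<close> enters squared through Young's inequality, which
  fixes the decay rate \<open>1 / r^12\<close> of the barrier.\<close>

lemma dev_laplacian_ge:
  assumes r: "r \<ge> R"
  shows "gap * ((dev1 r)\<^sup>2 + (dev2 r)\<^sup>2) - C\<^sup>2 / gap / r^12
    \<le> dev1 r * (dev1'' r + dev1' r / r) + dev2 r * (dev2'' r + dev2' r / r)"
proof -
  have r0: "r > 0" using r R by simp
  have "(C / r^6)\<^sup>2 / gap = C\<^sup>2 / gap / r^12"
    by (simp add: power_divide power_mult[symmetric])
  then show ?thesis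
    unfolding dev_laplacian[OF r0]
    using perturbed_form_ge[OF B products_close[OF r], of "rate1 r" "rate2 r" "residual1 r" "C / r^6"
        "residual2 r" "dev1 r" "dev2 r"] rates[OF r] residuals[OF r] e(3) by simp
qed

text \<open>The first summand lets the barrier dominate the source term, the second gives the
  comparison at \<open>r = R\<close>, and \<open>1\<close> ensures
  \<open>C1 <= C1^2\<close>.\<close>

definition "C1 = 2 * C\<^sup>2 / gap\<^sup>2 + 8 * R^12 + 1"

lemma C1_ge: "C1 \<ge> 1" "C1\<^sup>2 \<ge> 8 * R^12" "gap * C1\<^sup>2 \<ge> 2 * C\<^sup>2 / gap"
proof -
  have p: "2 * C\<^sup>2 / gap\<^sup>2 \<ge> 0" "R^12 \<ge> 0" using R by auto
  then show 1: "C1 \<ge> 1" by (simp add: C1_def)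
  have "C1 * 1 \<le> C1 * C1" using 1 by (intro mult_left_mono) auto
  then have "C1\<^sup>2 \<ge> C1" by (simp add: power2_eq_square)
  then have *: "C1\<^sup>2 \<ge> 8 * R^12" "C1\<^sup>2 \<ge> 2 * C\<^sup>2 / gap\<^sup>2" using p unfolding C1_def by linarith+
  then show "C1\<^sup>2 \<ge> 8 * R^12" by simp
  have "gap * (2 * C\<^sup>2 / gap\<^sup>2) \<le> gap * C1\<^sup>2" using * gap_pos by (intro mult_left_mono) auto
  then show "gap * C1\<^sup>2 \<ge> 2 * C\<^sup>2 / gap" using gap_pos by (simp add: power2_eq_square)
qed

text \<open>A multiple of \<open>1 / r ^ 12\<close> is a supersolution of the inequality satisfied by \<open>dev1\<^sup>2 + dev2\<^sup>2\<close>.\<close>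

lemma dev_squares_le:
  assumes x: "x \<ge> R"
  shows "(dev1 x)\<^sup>2 + (dev2 x)\<^sup>2 \<le> C1\<^sup>2 / x^12"
proof (rule field_le_epsilon)
  \<comment> \<open>At the outer end the deviations are only known to be small, so the comparison
    carries an arbitrary slack \<open>d\<close>.\<close>
  fix d :: real assume d: "d > 0"
  let ?Q = "\<lambda>r. (dev1 r)\<^sup>2 + (dev2 r)\<^sup>2"
  let ?p = "\<lambda>r. ?Q r - C1\<^sup>2 / r^12"
  have "(?Q \<longlongrightarrow> 0\<^sup>2 + 0\<^sup>2) at_top" by (intro tendsto_intros dev_tendsto_0)
  then have "eventually (\<lambda>r. ?Q r < d) at_top" using d by (intro order_tendstoD(2)) auto
  then have "eventually (\<lambda>r. ?Q r < d \<and> r > x) at_top"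
    using eventually_conj eventually_gt_at_top by blast
  then obtain S where S: "?Q S < d" "S > x"
    using eventually_happens'[OF trivial_limit_at_top_linorder] by blast
  have "?p x \<le> d"
  proof (rule radial_max_principle[where p = ?p and a = R and b = S
        and p' = "\<lambda>r. 2 * dev1 r * dev1' r + 2 * dev2 r * dev2' r + 12 * C1\<^sup>2 / r^13"
        and p'' = "\<lambda>r. 2 * (dev1' r)\<^sup>2 + 2 * (dev2' r)\<^sup>2 + 2 * dev1 r * dev1'' r
           + 2 * dev2 r * dev2'' r - 156 * C1\<^sup>2 / r^14"])
    have D: "(?p has_real_derivative 2 * dev1 r * dev1' r + 2 * dev2 r * dev2' r + 12 * C1\<^sup>2 / r^13) (at r)"
      if "r > 0" for r
      using that by (auto intro!: derivative_eq_intros radial_laplacian_sum_squares(1) dev_deriv)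
        (simp add: field_simps eval_nat_numeral)
    show "continuous_on {R..S} ?p"
      using R by (intro continuous_at_imp_continuous_on ballI DERIV_isCont[OF D]) auto
    fix r assume r: "R < r" "r < S"
    then have r0: "r > 0" using R by simp
    show "(?p has_real_derivative 2 * dev1 r * dev1' r + 2 * dev2 r * dev2' r + 12 * C1\<^sup>2 / r^13) (at r)"
      by (rule D[OF r0])
    show "((\<lambda>r. 2 * dev1 r * dev1' r + 2 * dev2 r * dev2' r + 12 * C1\<^sup>2 / r^13) has_real_derivative
        2 * (dev1' r)\<^sup>2 + 2 * (dev2' r)\<^sup>2 + 2 * dev1 r * dev1'' r
           + 2 * dev2 r * dev2'' r - 156 * C1\<^sup>2 / r^14) (at r)"
      using r0 by (auto intro!: derivative_eq_intros radial_laplacian_sum_squares(2)[where f = dev1 and g = dev2]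
          dev_deriv) (simp add: field_simps eval_nat_numeral)
    assume "?p r > d"
    then have "C1\<^sup>2 / r^12 < ?Q r" using d by simp
    then have 1: "gap * (C1\<^sup>2 / r^12) < gap * ?Q r" using gap_pos by (rule mult_strict_left_mono)
    have "144 / r\<^sup>2 \<le> 144 / R\<^sup>2" using r R by (intro divide_left_mono power_mono) auto
    then have "144 / r\<^sup>2 \<le> gap" using R by simp
    then have 2: "144 / r\<^sup>2 * (C1\<^sup>2 / r^12) \<le> gap * (C1\<^sup>2 / r^12)"
      using r0 by (intro mult_right_mono) auto
    have "2 * C\<^sup>2 / gap / r^12 \<le> gap * C1\<^sup>2 / r^12"
      using C1_ge(3) r0 by (intro divide_right_mono) auto
    then have 3: "2 * (C\<^sup>2 / gap / r^12) \<le> gap * (C1\<^sup>2 / r^12)" by simp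
    note 4 = dev_laplacian_ge[of r]
    have "2 * (dev1' r)\<^sup>2 + 2 * (dev2' r)\<^sup>2 + 2 * dev1 r * dev1'' r + 2 * dev2 r * dev2'' r
        - 156 * C1\<^sup>2 / r^14 + (2 * dev1 r * dev1' r + 2 * dev2 r * dev2' r + 12 * C1\<^sup>2 / r^13) / r
      = 2 * (dev1' r)\<^sup>2 + 2 * (dev2' r)\<^sup>2 + 2 * (dev1 r * (dev1'' r + dev1' r / r)
        + dev2 r * (dev2'' r + dev2' r / r)) - 144 / r\<^sup>2 * (C1\<^sup>2 / r^12)"
      using r0 by (simp add: field_simps eval_nat_numeral)
    also have "\<dots> > 0"
    proof -
      have "2 * (dev1' r)\<^sup>2 \<ge> 0" "2 * (dev2' r)\<^sup>2 \<ge> 0" by auto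
      \<comment> \<open>\<open>2 * gap * ?Q r\<close> exceeds
        \<open>2 * gap * (C1^2 / r^12)\<close>: one half pays for the Laplacian of the barrier, the
        other for the source term.\<close>
      with 1 2 3 4 r show ?thesis by argo
    qed
    finally show "2 * (dev1' r)\<^sup>2 + 2 * (dev2' r)\<^sup>2 + 2 * dev1 r * dev1'' r + 2 * dev2 r * dev2'' r
        - 156 * C1\<^sup>2 / r^14 + (2 * dev1 r * dev1' r + 2 * dev2 r * dev2' r + 12 * C1\<^sup>2 / r^13) / r > 0" .
  next
    \<comment> \<open>Solution and profile are both within \<open>e <= 1\<close> of the limit at
      \<open>R\<close>; hence the \<open>8\<close> in \<open>C1\<close>.\<close>
    have "\<bar>dev1 R\<bar> \<le> 2" "\<bar>dev2 R\<bar> \<le> 2"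
      using near[of R] e(2) unfolding dev1_def dev2_def by auto
    then have "(dev1 R)\<^sup>2 \<le> 2\<^sup>2" "(dev2 R)\<^sup>2 \<le> 2\<^sup>2"
      unfolding abs_le_square_iff[symmetric] by auto
    moreover have "8 \<le> C1\<^sup>2 / R^12" using C1_ge(2) R by (simp add: field_simps)
    ultimately show "?p R \<le> d" using d by simp
    have "C1\<^sup>2 / S^12 \<ge> 0" by simp
    then show "?p S \<le> d" using S by linarith
    show "x \<in> {R..S}" using x S by auto
  qed
  then show "?Q x \<le> C1\<^sup>2 / x^12 + d" by simp
qed

lemma dev_le:
  assumes x: "x \<ge> R"
  shows "\<bar>dev1 x\<bar> \<le> C1 / x^6" "\<bar>dev2 x\<bar> \<le> C1 / x^6"
proof -
  have "C1\<^sup>2 / x^12 = (C1 / x^6)\<^sup>2" by (simp add: power_divide power_mult[symmetric])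
  with dev_squares_le[OF x] have "(dev1 x)\<^sup>2 \<le> (C1 / x^6)\<^sup>2" "(dev2 x)\<^sup>2 \<le> (C1 / x^6)\<^sup>2"
    using zero_le_power2[of "dev1 x"] zero_le_power2[of "dev2 x"] by linarith+
  then have "\<bar>dev1 x\<bar> \<le> \<bar>C1 / x^6\<bar>" "\<bar>dev2 x\<bar> \<le> \<bar>C1 / x^6\<bar>"
    by (simp_all only: abs_le_square_iff)
  moreover have "C1 / x^6 \<ge> 0" using C1_ge(1) by simp
  ultimately show "\<bar>dev1 x\<bar> \<le> C1 / x^6" "\<bar>dev2 x\<bar> \<le> C1 / x^6" by auto
qed

definition "H = gap * C1 + 2 * (A1 + A2 + B0) * (t1 + t2)\<^sup>2 * C1 + C"

text \<open>Each term of \<open>dev_laplacian\<close> is a bounded coefficient times a deviation of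
  size at most \<open>C1 / r^6\<close>, or a residual.\<close>

lemma dev_laplacian_le:
  assumes r: "r \<ge> R"
  shows "\<bar>dev1'' r + dev1' r / r\<bar> \<le> 2 * H / r^6" "\<bar>dev2'' r + dev2' r / r\<bar> \<le> 2 * H / r^6"
proof -
  have r0: "r > 0" using r R by simp
  define h where "h = (4 * (t1 + t2) + 2) * e"
  define m where "m = 2 * (t1 + t2)\<^sup>2 + h"
  define y where "y = C1 / r^6"
  have y0: "y \<ge> 0" using C1_ge(1) by (simp add: y_def)
  have h0: "h \<ge> 0" using t1 t2 e by (simp add: h_def)
  have m0: "m \<ge> 0" using h0 by (simp add: m_def)
  have tt: "t1 * t1 \<le> (t1 + t2)\<^sup>2" "t1 * t2 \<le> (t1 + t2)\<^sup>2" "t2 * t1 \<le> (t1 + t2)\<^sup>2" "t2 * t2 \<le> (t1 + t2)\<^sup>2"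
    "0 \<le> t1 * t1" "0 \<le> t1 * t2" "0 \<le> t2 * t1" "0 \<le> t2 * t2"
    using t1 t2 by (auto simp: power2_eq_square intro!: mult_mono)
  have P: "\<bar>f r * (f r + p1 B r)\<bar> \<le> m" "\<bar>f r * (g r + p2 B r)\<bar> \<le> m"
    "\<bar>g r * (f r + p1 B r)\<bar> \<le> m" "\<bar>g r * (g r + p2 B r)\<bar> \<le> m"
    using products_close[OF r] tt unfolding m_def h_def[symmetric] abs_le_iff by linarith+
  have bd: "\<bar>k * u + A * P * u + B * P' * v - q\<bar> \<le> gap / 4 * y + A * m * y + B0 * m * y + C / r^6"
    if "\<bar>k\<bar> \<le> gap / 4" "\<bar>u\<bar> \<le> y" "\<bar>v\<bar> \<le> y" "A > 0" "\<bar>P\<bar> \<le> m" "\<bar>P'\<bar> \<le> m" "\<bar>q\<bar> \<le> C / r^6"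
    for k u v A P P' q
  proof -
    have "\<bar>k * u\<bar> \<le> gap / 4 * y"
      unfolding abs_mult using that(1,2) gap_pos by (intro mult_mono) auto
    moreover have "\<bar>A * P * u\<bar> \<le> A * m * y" "\<bar>B * P' * v\<bar> \<le> B0 * m * y"
      unfolding abs_mult using that B B0 y0 m0 by (auto intro!: mult_mono)
    ultimately show ?thesis using that(7) by linarith
  qed
  have My: "0 \<le> A1 * m * y" "0 \<le> A2 * m * y" using A1 A2 m0 y0 by auto
  have "h * (A1 + A2 + B0) * y \<le> gap / 4 * y"
    using e(3) y0 unfolding h_def by (intro mult_right_mono) auto
  then have my: "A1 * m * y + A2 * m * y + B0 * m * y
      \<le> 2 * (A1 + A2 + B0) * (t1 + t2)\<^sup>2 * y + gap / 4 * y"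
    unfolding m_def by (simp add: algebra_simps)
  have Hr: "H / r^6 = gap * y + 2 * (A1 + A2 + B0) * (t1 + t2)\<^sup>2 * y + C / r^6"
    by (simp add: H_def y_def add_divide_distrib)
  have "H / r^6 \<ge> 0" unfolding Hr using gap_pos A1 A2 B0 y0 C r0 by auto
  moreover have "gap * y \<ge> 0" using gap_pos y0 by simp
  ultimately have fin: "gap / 4 * y + A1 * m * y + B0 * m * y + C / r^6 \<le> 2 * H / r^6"
    "gap / 4 * y + A2 * m * y + B0 * m * y + C / r^6 \<le> 2 * H / r^6"
    using my My Hr by argo+
  note dl = dev_le[OF r, folded y_def]
  show "\<bar>dev1'' r + dev1' r / r\<bar> \<le> 2 * H / r^6"
    unfolding dev_laplacian[OF r0]
    by (rule order_trans[OF bd fin(1)]) (use rates[OF r] residuals[OF r] dl A1 P in auto)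
  show "\<bar>dev2'' r + dev2' r / r\<bar> \<le> 2 * H / r^6"
    unfolding dev_laplacian[OF r0]
    by (rule order_trans[OF bd fin(2)]) (use rates[OF r] residuals[OF r] dl A2 P in auto)
qed

lemma H_pos: "H > 0"
  unfolding H_def using gap_pos C1_ge(1) A1 A2 B0 C t1 t2
  by (intro add_nonneg_pos add_nonneg_nonneg mult_nonneg_nonneg) auto

text \<open>The interior estimate gives \<open>4 * C1 + 4 * H\<close> for the derivative of the
  deviation; \<open>C\<close> covers the term \<open>4 b / r^5\<close>, which the final estimate
  leaves out of the expansion.\<close>

definition "C2 = 4 * C1 + 4 * H + C"

lemma gradient_le:
  assumes x: "x \<ge> R"
  shows "\<bar>deriv f x + 2 * a1 B / x^3\<bar> \<le> C2 / x^5" "\<bar>deriv g x + 2 * a2 B / x^3\<bar> \<le> C2 / x^5"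
proof -
  have x1: "x \<ge> 1" using x R by simp
  \<comment> \<open>Bounds on \<open>{x..x+1}\<close> are largest at the left end.\<close>
  have anti: "c / r^6 \<le> c / x^6" if "r \<in> {x..x+1}" "c \<ge> 0" for r c
    using that x1 by (intro divide_left_mono power_mono) auto
  have c: "C1 \<ge> 0" "2 * H \<ge> 0" using C1_ge(1) H_pos by auto
  have g: "\<bar>dev1' x\<bar> \<le> 4 * (C1 / x^6) + 2 * (2 * H / x^6)"
    "\<bar>dev2' x\<bar> \<le> 4 * (C1 / x^6) + 2 * (2 * H / x^6)"
    by (rule radial_gradient_bound[OF x1 dev_deriv(1,2)];
        use x x1 c in \<open>auto intro: order_trans[OF dev_le(1) anti] order_trans[OF dev_laplacian_le(1) anti]\<close>)
      (rule radial_gradient_bound[OF x1 dev_deriv(3,4)];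
        use x x1 c in \<open>auto intro: order_trans[OF dev_le(2) anti] order_trans[OF dev_laplacian_le(2) anti]\<close>)
  have "(4 * C1 + 4 * H) / x^6 \<le> (4 * C1 + 4 * H) / x^5"
    using c x1 by (intro divide_left_mono power_increasing) auto
  then have g': "\<bar>dev1' x\<bar> \<le> (4 * C1 + 4 * H) / x^5" "\<bar>dev2' x\<bar> \<le> (4 * C1 + 4 * H) / x^5"
    using g by (auto simp: add_divide_distrib)
  have "\<bar>4 * b1 B / x^5\<bar> \<le> C / x^5" "\<bar>4 * b2 B / x^5\<bar> \<le> C / x^5"
    using b_le x1 by (auto simp: abs_mult divide_right_mono)
  then show "\<bar>deriv f x + 2 * a1 B / x^3\<bar> \<le> C2 / x^5" "\<bar>deriv g x + 2 * a2 B / x^3\<bar> \<le> C2 / x^5"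
    using g' unfolding dev1'_def dev2'_def C2_def abs_le_iff add_divide_distrib by linarith+
qed

end

section \<open>Choice of the constants and the final statements\<close>

lemma (in radial_parameters) uniform_expansion:
  "\<exists>C1>0. \<exists>C2>0. \<exists>R>0. \<forall>B f g. radial_pair A1 A2 t1 t2 n1 n2 B0 B f g \<longrightarrow> (\<forall>r\<ge>R.
    \<bar>f r - p1 B r\<bar> \<le> C1 / r^6 \<and> \<bar>g r - p2 B r\<bar> \<le> C1 / r^6 \<and>
    \<bar>deriv f r + 2 * a1 B / r^3\<bar> \<le> C2 / r^5 \<and> \<bar>deriv g r + 2 * a2 B / r^3\<bar> \<le> C2 / r^5)"
proof -
  interpret swap: radial_parameters A2 A1 t2 t1 n2 n1 B0 by (rule swapped)
  have sw: "swap.a1 = a2" "swap.b1 = b2" "swap.p1 = p2" "swap.p2 = p1"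
    by (auto simp: swap.a1_def swap.b1_def a2_def b2_def p1_def p2_def swap.p1_def swap.p2_def
        swap.a2_def swap.b2_def a1_def b1_def)
  obtain Ca where Ca: "Ca > 0" "\<And>B r. \<bar>B\<bar> \<le> B0 \<Longrightarrow> r \<ge> 1 \<Longrightarrow>
    \<bar>p1 B r - t1\<bar> \<le> Ca / r^2 \<and> \<bar>rate A1 B t1 t2 n1 (p1 B r) (p2 B r) r\<bar> \<le> Ca / r^4 \<and>
    \<bar>4 * a1 B / r^4 + 16 * b1 B / r^6 - rate A1 B t1 t2 n1 (p1 B r) (p2 B r) r * p1 B r\<bar> \<le> Ca / r^6 \<and>
    4 * \<bar>b1 B\<bar> \<le> Ca"
    using half_profile_estimates by blast
  obtain Cb where Cb: "Cb > 0" "\<And>B r. \<bar>B\<bar> \<le> B0 \<Longrightarrow> r \<ge> 1 \<Longrightarrow>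
    \<bar>p2 B r - t2\<bar> \<le> Cb / r^2 \<and> \<bar>rate A2 B t2 t1 n2 (p2 B r) (p1 B r) r\<bar> \<le> Cb / r^4 \<and>
    \<bar>4 * a2 B / r^4 + 16 * b2 B / r^6 - rate A2 B t2 t1 n2 (p2 B r) (p1 B r) r * p2 B r\<bar> \<le> Cb / r^6 \<and>
    4 * \<bar>b2 B\<bar> \<le> Cb"
    using swap.half_profile_estimates[unfolded sw] by blast
  define C where "C = max Ca Cb"
  have C: "C > 0" "Ca \<le> C" "Cb \<le> C" using Ca(1) by (auto simp: C_def)
  \<comment> \<open>\<open>K * e <= gap\<close> is four times the smallness condition on
    \<open>e\<close>.\<close>
  define K where "K = 4 * (4 * (t1 + t2) + 2) * (A1 + A2 + B0)"
  have K: "K > 0" using t1 t2 A1 A2 B0 by (simp add: K_def add_pos_pos)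
  define e where "e = min 1 (gap / K)"
  have e: "e > 0" "e \<le> 1" "e \<le> gap / K" using gap_pos K by (auto simp: e_def)
  have "K * e \<le> gap" using e(3) K by (simp add: field_simps)
  then have e3: "(4 * (t1 + t2) + 2) * e * (A1 + A2 + B0) \<le> gap / 4"
    by (simp add: K_def algebra_simps)
  obtain R0 where R0: "R0 \<ge> 1" "\<And>B f g r. radial_pair A1 A2 t1 t2 n1 n2 B0 B f g \<Longrightarrow> r \<ge> R0 \<Longrightarrow>
    \<bar>f r - t1\<bar> \<le> e \<and> \<bar>g r - t2\<bar> \<le> e"
    using uniform_convergence[OF e(1)] by blast
  \<comment> \<open>The summands serve, in order, the convergence of the solution, the closeness of
    the profile, the rates and the barrier. As \<open>r >= 1\<close> gives \<open>r <= r^2\<close>,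
    no square roots are required.\<close>
  define R where "R = R0 + C / e + 4 * C / gap + 144 / gap"
  have pos: "C / e > 0" "4 * C / gap > 0" "144 / gap > 0" using C e gap_pos by auto
  have R: "R \<ge> R0" "R \<ge> 1" "R \<ge> C / e" "R \<ge> 4 * C / gap" "R \<ge> 144 / gap"
    unfolding R_def using pos R0 by linarith+
  have sq: "c / r\<^sup>2 \<le> d" if "c / d \<le> R" "d > 0" "r \<ge> R" for c d r
  proof -
    have "r * 1 \<le> r * r" using that R by (intro mult_left_mono) auto
    then have "c / d \<le> r\<^sup>2" using that by (simp add: power2_eq_square)
    then show ?thesis using that R by (simp add: field_simps)
  qed
  have far: "radial_pair_far A1 A2 t1 t2 n1 n2 B0 B f g C e R"
    if pair: "radial_pair A1 A2 t1 t2 n1 n2 B0 B f g" for B f g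
  proof -
    interpret radial_pair A1 A2 t1 t2 n1 n2 B0 B f g by (rule pair)
    have mono: "Ca / r^k \<le> C / r^k" "Cb / r^k \<le> C / r^k" if "r \<ge> R" for r k
      using C that R by (auto intro!: divide_right_mono)
    have C2e: "C / r\<^sup>2 \<le> e" if "r \<ge> R" for r using sq[OF R(3) e(1) that] .
    have C4: "C / r^4 \<le> gap / 4" if "r \<ge> R" for r
    proof -
      have "C / r^4 \<le> C / r^2" using C that R by (intro divide_left_mono power_increasing) auto
      also have "\<dots> \<le> gap / 4" using gap_pos R(4) by (intro sq that) (auto simp: mult.commute)
      finally show ?thesis .
    qed
    show ?thesis
    proof
      show "144 / R\<^sup>2 \<le> gap" using sq[OF R(5) gap_pos] by simp
      show "4 * \<bar>b1 B\<bar> \<le> C" "4 * \<bar>b2 B\<bar> \<le> C"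
        using Ca(2)[OF B, of 1] Cb(2)[OF B, of 1] C by auto
      fix r assume r: "r \<ge> R"
      then have r1: "r \<ge> 1" using R by simp
      note ca = Ca(2)[OF B r1] and cb = Cb(2)[OF B r1]
      note ca3 = ca[THEN conjunct2, THEN conjunct2, THEN conjunct1]
        and cb3 = cb[THEN conjunct2, THEN conjunct2, THEN conjunct1]
      note small = order_trans[OF mono(1)[OF r] C2e[OF r]] order_trans[OF mono(2)[OF r] C2e[OF r]]
        order_trans[OF mono(1)[OF r] C4[OF r]] order_trans[OF mono(2)[OF r] C4[OF r]]
      show "\<bar>f r - t1\<bar> \<le> e \<and> \<bar>g r - t2\<bar> \<le> e \<and> \<bar>p1 B r - t1\<bar> \<le> e \<and> \<bar>p2 B r - t2\<bar> \<le> e"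
        using R0(2)[OF pair order_trans[OF R(1) r]] order_trans[OF ca[THEN conjunct1] small(1)]
          order_trans[OF cb[THEN conjunct1] small(2)] by blast
      show "\<bar>rate1 r\<bar> \<le> gap / 4 \<and> \<bar>rate2 r\<bar> \<le> gap / 4"
        unfolding rate1_def rate2_def
        using order_trans[OF ca[THEN conjunct2, THEN conjunct1] small(3)]
          order_trans[OF cb[THEN conjunct2, THEN conjunct1] small(4)] by blast
      show "\<bar>residual1 r\<bar> \<le> C / r^6 \<and> \<bar>residual2 r\<bar> \<le> C / r^6"
        unfolding residual1_def residual2_def rate1_def rate2_def
        using order_trans[OF ca3 mono(1)[OF r]] order_trans[OF cb3 mono(2)[OF r]] by blast
    qed (use e e3 R C in auto)
  qed
  \<comment> \<open>\<open>C1\<close>, \<open>H\<close> and \<open>C2\<close> written out before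
    \<open>B\<close>, \<open>f\<close> and \<open>g\<close> are fixed, as the order of quantifiers
    demands.\<close>
  define D1 where "D1 = 2 * C\<^sup>2 / gap\<^sup>2 + 8 * R^12 + 1"
  define D3 where "D3 = gap * D1 + 2 * (A1 + A2 + B0) * (t1 + t2)\<^sup>2 * D1 + C"
  define D2 where "D2 = 4 * D1 + 4 * D3 + C"
  have D1: "D1 > 0" using R by (simp add: D1_def add_nonneg_pos)
  have "D3 > 0" unfolding D3_def using D1 gap_pos A1 A2 B0 C(1)
    by (intro add_nonneg_pos add_nonneg_nonneg mult_nonneg_nonneg) auto
  then have D2: "D2 > 0" using D1 C by (simp add: D2_def)
  show ?thesis
  proof (rule exI[of _ D1], intro conjI D1, rule exI[of _ D2], intro conjI D2, rule exI[of _ R],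
      intro conjI allI impI)
    show "R > 0" using R by simp
    fix B f g r assume pair: "radial_pair A1 A2 t1 t2 n1 n2 B0 B f g" and r: "R \<le> r"
    interpret radial_pair_far A1 A2 t1 t2 n1 n2 B0 B f g C e R by (rule far[OF pair])
    have eqs: "C1 = D1" "C2 = D2" by (simp_all add: C1_def D1_def C2_def D2_def H_def D3_def)
    show "\<bar>f r - p1 B r\<bar> \<le> D1 / r^6" "\<bar>g r - p2 B r\<bar> \<le> D1 / r^6"
      using dev_le[OF r] by (auto simp: eqs dev1_def dev2_def)
    show "\<bar>deriv f r + 2 * a1 B / r^3\<bar> \<le> D2 / r^5" "\<bar>deriv g r + 2 * a2 B / r^3\<bar> \<le> D2 / r^5"
      using gradient_le[OF r] by (auto simp: eqs)
  qed
qed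

theorem theorem3p2:
  fixes Ap Am tp tm :: real and np nm :: int
  assumes "Ap > 0" and "Am > 0" and "tp > 0" and "tm > 0"
  shows
    "(\<forall>B fp fm. B\<^sup>2 < Ap * Am \<longrightarrow> radial_solution Ap Am B tp tm np nm fp fm \<longrightarrow>
        (\<lambda>r. fp r - (tp + coeff_a Ap Am B tp np nm / r^2
                        + coeff_b Ap Am B tp tm np nm / r^4)) \<in> O[at_top](\<lambda>r. 1 / r^6) \<and>
        (\<lambda>r. fm r - (tm + coeff_a Am Ap B tm nm np / r^2
                        + coeff_b Am Ap B tm tp nm np / r^4)) \<in> O[at_top](\<lambda>r. 1 / r^6))
     \<and>
     (\<forall>B0>0. Ap * Am - B0\<^sup>2 > 0 \<longrightarrow>
        (\<exists>C1>0. \<exists>C2>0. \<exists>R>0. \<forall>B. \<bar>B\<bar> \<le> B0 \<longrightarrow>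
          (\<forall>fp fm. radial_solution Ap Am B tp tm np nm fp fm \<longrightarrow>
            (\<forall>r\<ge>R.
               \<bar>fp r - (tp + coeff_a Ap Am B tp np nm / r^2
                           + coeff_b Ap Am B tp tm np nm / r^4)\<bar> \<le> C1 / r^6 \<and>
               \<bar>fm r - (tm + coeff_a Am Ap B tm nm np / r^2
                           + coeff_b Am Ap B tm tp nm np / r^4)\<bar> \<le> C1 / r^6 \<and>
               \<bar>deriv fp r + 2 * coeff_a Ap Am B tp np nm / r^3\<bar> \<le> C2 / r^5 \<and>
               \<bar>deriv fm r + 2 * coeff_a Am Ap B tm nm np / r^3\<bar> \<le> C2 / r^5))))"
    (is "?asymptotic \<and> ?uniform")
proof
  show uniform: ?uniform
  proof (intro allI impI)
    fix B0 :: real assume B0: "0 < B0" "0 < Ap * Am - B0\<^sup>2"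
    interpret radial_parameters Ap Am tp tm np nm B0 using assms B0 by unfold_locales
    have pair: "radial_pair Ap Am tp tm np nm B0 B fp fm"
      if "\<bar>B\<bar> \<le> B0" "radial_solution Ap Am B tp tm np nm fp fm" for B fp fm
      using that by unfold_locales (auto simp: radial_solution_def)
    show "\<exists>C1>0. \<exists>C2>0. \<exists>R>0. \<forall>B. \<bar>B\<bar> \<le> B0 \<longrightarrow>
          (\<forall>fp fm. radial_solution Ap Am B tp tm np nm fp fm \<longrightarrow>
            (\<forall>r\<ge>R.
               \<bar>fp r - (tp + coeff_a Ap Am B tp np nm / r^2
                           + coeff_b Ap Am B tp tm np nm / r^4)\<bar> \<le> C1 / r^6 \<and>
               \<bar>fm r - (tm + coeff_a Am Ap B tm nm np / r^2
                           + coeff_b Am Ap B tm tp nm np / r^4)\<bar> \<le> C1 / r^6 \<and>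
               \<bar>deriv fp r + 2 * coeff_a Ap Am B tp np nm / r^3\<bar> \<le> C2 / r^5 \<and>
               \<bar>deriv fm r + 2 * coeff_a Am Ap B tm nm np / r^3\<bar> \<le> C2 / r^5))"
      using uniform_expansion pair
      unfolding p1_def p2_def profile_def a1_def a2_def b1_def b2_def by meson
  qed
  show ?asymptotic
  proof (intro allI impI)
    fix B fp fm assume B: "B\<^sup>2 < Ap * Am" and sol: "radial_solution Ap Am B tp tm np nm fp fm"
    \<comment> \<open>\<open>B0^2\<close> is the midpoint between \<open>B^2\<close> and
      \<open>Ap * Am\<close>, so the uniform estimate applies to this single
      \<open>B\<close>.\<close>
    define B0 where "B0 = sqrt ((B\<^sup>2 + Ap * Am) / 2)"
    have nonneg: "(B\<^sup>2 + Ap * Am) / 2 > 0" using assms by (simp add: add_nonneg_pos)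
    then have "B0 > 0" by (simp add: B0_def)
    have sq: "B0\<^sup>2 = (B\<^sup>2 + Ap * Am) / 2" using nonneg by (simp add: B0_def)
    then have det: "Ap * Am - B0\<^sup>2 > 0" and "B\<^sup>2 \<le> B0\<^sup>2" using B by auto
    then have "\<bar>B\<bar> \<le> B0" using \<open>B0 > 0\<close> by (simp add: abs_le_square_iff[symmetric])
    with uniform \<open>B0 > 0\<close> det sol obtain C1 R where est: "\<And>r. r \<ge> R \<Longrightarrow>
        \<bar>fp r - (tp + coeff_a Ap Am B tp np nm / r^2 + coeff_b Ap Am B tp tm np nm / r^4)\<bar> \<le> C1 / r^6 \<and>
        \<bar>fm r - (tm + coeff_a Am Ap B tm nm np / r^2 + coeff_b Am Ap B tm tp nm np / r^4)\<bar> \<le> C1 / r^6"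
      by meson
    have bigo: "h \<in> O[at_top](\<lambda>r. 1 / r^6)" if "\<And>r. r \<ge> R \<Longrightarrow> \<bar>h r\<bar> \<le> C1 / r^6" for h :: "real \<Rightarrow> real"
      by (rule bigoI[of _ C1], rule eventually_mono[OF eventually_ge_at_top[of R]]) (use that in simp)
    show "(\<lambda>r. fp r - (tp + coeff_a Ap Am B tp np nm / r^2
                        + coeff_b Ap Am B tp tm np nm / r^4)) \<in> O[at_top](\<lambda>r. 1 / r^6) \<and>
        (\<lambda>r. fm r - (tm + coeff_a Am Ap B tm nm np / r^2
                        + coeff_b Am Ap B tm tp nm np / r^4)) \<in> O[at_top](\<lambda>r. 1 / r^6)"
      using est by (intro conjI bigo) auto
  qed
qed

end
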